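(* Let $G$ be a graph with $\mathrm{mad}(G)<6$. Then $\chi_c^{\star}(G)\leq 8$. In particular every $K_5$-minor-free graph, and hence every planar graph, $G$ satisfies $\chi_c^\star(G)\le 8$.
   Context: All graphs are finite and simple. $\mathrm{mad}(G)$ denotes the maximum, over all subgraphs of $G$, of their average degree. A correspondence-cover of a graph $G$ is a pair $(L,H)$ where $H$ is a graph and $L$ maps each $v\in V(G)$ to a subset $L(v)\subseteq V(H)$ such that: the sets $L(v)$ partition $V(H)$; each $L(v)$ induces a clique in $H$; if $uv\notin E(G)$ there are no edges of $H$ between $L(u)$ and $L(v)$; if $uv\in E(G)$ the edges of $H$ between $L(u)$ and $L(v)$ form a matching. The cover is $k$-fold if $|L(v)|=k$ for all $v$. An independent transversal of $(L,H)$ is an independent set of $H$ containing exactly one vertex of each $L(v)$. A $k$-fold cover has a packing if it has $k$ pairwise vertex-disjoint independent transversals. The correspondence packing number $\chi_c^{\star}(G)$ is the least $k\geq 1$ such that every $k$-fold correspondence-cover of $G$ has a packing. *)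

theory Defs
  imports Complex_Main
begin

definition simple_graph :: "'a set \<Rightarrow> 'a set set \<Rightarrow> bool" where
  "simple_graph V E \<longleftrightarrow> finite V \<and>
     (\<forall>e\<in>E. \<exists>u v. e = {u, v} \<and> u \<noteq> v \<and> u \<in> V \<and> v \<in> V)"

definition mad :: "'a set \<Rightarrow> 'a set set \<Rightarrow> real" where
  "mad V E = Max {2 * real (card E') / real (card V') | V' E'.
                   V' \<subseteq> V \<and> V' \<noteq> {} \<and> E' \<subseteq> E \<and> (\<forall>e\<in>E'. e \<subseteq> V')}"

text \<open>Correspondence cover (L,H) of G=(V,E). The vertices of H are taken from the type
  'a \<times> nat (any finite cover is isomorphic to one of this form); V(H) is the union of
  the lists L v, v in V, and HE is the edge set of H.\<close>
definition corr_cover :: "'a set \<Rightarrow> 'a set set \<Rightarrow> ('a \<Rightarrow> ('a \<times> nat) set)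
                          \<Rightarrow> ('a \<times> nat) set set \<Rightarrow> bool" where
  "corr_cover V E L HE \<longleftrightarrow>
     simple_graph (\<Union>(L ` V)) HE \<and>
     (\<forall>u\<in>V. \<forall>v\<in>V. u \<noteq> v \<longrightarrow> L u \<inter> L v = {}) \<and>
     (\<forall>v\<in>V. \<forall>x\<in>L v. \<forall>y\<in>L v. x \<noteq> y \<longrightarrow> {x, y} \<in> HE) \<and>
     (\<forall>u\<in>V. \<forall>v\<in>V. u \<noteq> v \<longrightarrow> {u, v} \<notin> E \<longrightarrow>
        (\<forall>x\<in>L u. \<forall>y\<in>L v. {x, y} \<notin> HE)) \<and>
     (\<forall>u\<in>V. \<forall>v\<in>V. {u, v} \<in> E \<longrightarrow>
        (\<forall>x\<in>L u. \<forall>y1\<in>L v. \<forall>y2\<in>L v. {x, y1} \<in> HE \<longrightarrow> {x, y2} \<in> HE \<longrightarrow> y1 = y2))"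

definition k_fold_cover :: "nat \<Rightarrow> 'a set \<Rightarrow> 'a set set \<Rightarrow> ('a \<Rightarrow> ('a \<times> nat) set)
                          \<Rightarrow> ('a \<times> nat) set set \<Rightarrow> bool" where
  "k_fold_cover k V E L HE \<longleftrightarrow> corr_cover V E L HE \<and> (\<forall>v\<in>V. finite (L v) \<and> card (L v) = k)"

definition indep_transversal :: "'a set \<Rightarrow> ('a \<Rightarrow> ('a \<times> nat) set)
                          \<Rightarrow> ('a \<times> nat) set set \<Rightarrow> ('a \<times> nat) set \<Rightarrow> bool" where
  "indep_transversal V L HE T \<longleftrightarrow> T \<subseteq> \<Union>(L ` V) \<and>
     (\<forall>v\<in>V. card (T \<inter> L v) = 1) \<and> (\<forall>x\<in>T. \<forall>y\<in>T. {x, y} \<notin> HE)"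

definition has_packing :: "nat \<Rightarrow> 'a set \<Rightarrow> ('a \<Rightarrow> ('a \<times> nat) set)
                          \<Rightarrow> ('a \<times> nat) set set \<Rightarrow> bool" where
  "has_packing k V L HE \<longleftrightarrow> (\<exists>T :: nat \<Rightarrow> ('a \<times> nat) set.
     (\<forall>i<k. indep_transversal V L HE (T i)) \<and>
     (\<forall>i<k. \<forall>j<k. i \<noteq> j \<longrightarrow> T i \<inter> T j = {}))"

definition chi_c_star :: "'a set \<Rightarrow> 'a set set \<Rightarrow> nat" where
  "chi_c_star V E = (LEAST k. 1 \<le> k \<and>
     (\<forall>L HE. k_fold_cover k V E L HE \<longrightarrow> has_packing k V L HE))"

definition connected_in :: "'a set set \<Rightarrow> 'a set \<Rightarrow> bool" where
  "connected_in E S \<longleftrightarrow> (\<forall>x\<in>S. \<forall>y\<in>S.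
     (\<lambda>a b. a \<in> S \<and> b \<in> S \<and> {a, b} \<in> E)\<^sup>*\<^sup>* x y)"

definition has_K5_minor :: "'a set \<Rightarrow> 'a set set \<Rightarrow> bool" where
  "has_K5_minor V E \<longleftrightarrow> (\<exists>B :: nat \<Rightarrow> 'a set.
     (\<forall>i<5. B i \<noteq> {} \<and> B i \<subseteq> V \<and> connected_in E (B i)) \<and>
     (\<forall>i<5. \<forall>j<5. i \<noteq> j \<longrightarrow> B i \<inter> B j = {} \<and> (\<exists>u\<in>B i. \<exists>v\<in>B j. {u, v} \<in> E)))"

end

(*
  Write a packing as a permutation "index to colour" of 8 elements at each vertex. A neighbour
  forbids a partial matching of (index, colour) pairs, so extending a packing to a vertex means
  finding a perfect matching in an 8 by 8 bipartite graph. By Hall's theorem this works at a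
  vertex of degree at most 4, and at a vertex v of degree 5 it fails only if the forbidden pairs
  contain a complete 4 by 5 grid. Two permutations of one neighbour of v that both cause such a
  failure, the other four neighbours being fixed, agree on at least 3 of the 4 indices that the
  first contributes to its grid. Hence in a minimal non-packable sparse graph
  - no 5-vertex has a neighbour u of degree at most 6: at u every index and every colour has at
    least 3 allowed partners, so the permutation of u can be rerouted on two of those 4 indices;
  - no 7-vertex has six 5-neighbours: there are seven pairwise disjoint permutations available
    for it (cyclic shifts), and each 5-neighbour rules out at most one.
  Counting edges at 5-vertices shows that a graph of average degree below 6 contains a vertex of
  degree at most 4 or one of these two configurations.
  For graphs without K5 minor, sparsity is Mader's bound: in a minimal counterexample every edge
  lies in three triangles, and the neighbourhood of a vertex of degree at most 5 yields the minor.
*)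
theory Submission
  imports Defs
begin

section \<open>Perfect matchings avoiding a relation\<close>

text \<open>Rado's argument: if two elements x, y lie in A i, then deleting x or deleting y from A i
  preserves the hypothesis, by submodularity of the cardinality of unions.\<close>

theorem hall_sdr:
  fixes A :: "'i \<Rightarrow> 'b set"
  assumes "finite I" and "\<And>i. i \<in> I \<Longrightarrow> finite (A i)"
    and "\<And>J. J \<subseteq> I \<Longrightarrow> card J \<le> card (\<Union>(A ` J))"
  shows "\<exists>g. (\<forall>i\<in>I. g i \<in> A i) \<and> inj_on g I"
  using assms(2,3)
proof (induction "\<Sum>i\<in>I. card (A i)" arbitrary: A rule: less_induct)
  case less
  have pos: "A i \<noteq> {}" if "i \<in> I" for i
    using less.prems(2)[of "{i}"] that by auto
  have finU: "finite (\<Union>(A ` J))" if "J \<subseteq> I" for J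
    using that less.prems(1) \<open>finite I\<close> by (meson finite_UN_I finite_subset subsetD)
  show ?case
  proof (cases "\<exists>i\<in>I. \<exists>x\<in>A i. \<exists>y\<in>A i. x \<noteq> y")
    case False
    define g where "g i = (SOME x. x \<in> A i)" for i
    have g: "g i \<in> A i" if "i \<in> I" for i
      using pos[OF that] unfolding g_def by (simp add: some_in_eq)
    have single: "A i = {g i}" if "i \<in> I" for i using g[OF that] False that by blast
    have "inj_on g I"
    proof (rule inj_onI, rule ccontr)
      fix i j assume "i \<in> I" "j \<in> I" "g i = g j" "i \<noteq> j"
      with less.prems(2)[of "{i,j}"] single show False by simp
    qed
    with g show ?thesis by blast
  next
    case True
    then obtain i x y where ixy: "i \<in> I" "x \<in> A i" "y \<in> A i" "x \<noteq> y" by blast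
    let ?B = "\<lambda>z. A(i := A i - {z})"
    have smaller: "(\<Sum>j\<in>I. card (?B z j)) < (\<Sum>j\<in>I. card (A j))" if "z \<in> A i" for z
      using \<open>finite I\<close>
    proof (rule sum_strict_mono_ex1)
      show "\<forall>j\<in>I. card (?B z j) \<le> card (A j)"
        using less.prems(1) by (auto intro: card_mono)
      show "\<exists>j\<in>I. card (?B z j) < card (A j)"
        using card_Diff1_less[OF less.prems(1)[OF ixy(1)] that] ixy(1) by (intro bexI[of _ i]) auto
    qed
    have step: ?thesis if z: "z \<in> A i" and hall: "\<And>J. J \<subseteq> I \<Longrightarrow> card J \<le> card (\<Union>(?B z ` J))" for z
    proof -
      have "finite (?B z j)" if "j \<in> I" for j using less.prems(1) that ixy(1) by auto
      from less.hyps[OF smaller[OF z] this hall]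
      obtain g where g: "\<forall>j\<in>I. g j \<in> ?B z j" "inj_on g I" by blast
      have "g j \<in> A j" if "j \<in> I" for j using bspec[OF g(1) that] by (cases "j = i") auto
      with g(2) show ?thesis by blast
    qed
    \<comment> \<open>Only the set at \<open>i\<close> shrinks, so an index set violating the
      condition after the deletion contains \<open>i\<close>; \<open>J\<close> is that set without
      \<open>i\<close>.\<close>
    have viol: "\<exists>J\<subseteq>I - {i}. card (\<Union>(A ` J) \<union> (A i - {z})) \<le> card J"
      if nhall: "\<not> (\<forall>J\<subseteq>I. card J \<le> card (\<Union>(?B z ` J)))" for z
    proof -
      obtain J where J: "J \<subseteq> I" "card (\<Union>(?B z ` J)) < card J" using nhall by (meson not_le)
      have "i \<in> J"
      proof (rule ccontr)
        assume "i \<notin> J"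
        then have "\<Union>(?B z ` J) = \<Union>(A ` J)" by auto
        with J less.prems(2)[OF J(1)] show False by simp
      qed
      have eq: "\<Union>(?B z ` J) = \<Union>(A ` (J - {i})) \<union> (A i - {z})" using \<open>i \<in> J\<close> by auto
      have "card J = Suc (card (J - {i}))"
        using \<open>i \<in> J\<close> finite_subset[OF J(1) \<open>finite I\<close>] by (metis card_Suc_Diff1)
      then have "card (\<Union>(A ` (J - {i})) \<union> (A i - {z})) \<le> card (J - {i})" using J(2) unfolding eq by linarith
      moreover have "J - {i} \<subseteq> I - {i}" using J(1) by blast
      ultimately show ?thesis by blast
    qed
    show ?thesis
    proof (rule ccontr)
      assume no: "\<not> ?thesis"
      obtain J where J: "J \<subseteq> I - {i}" "card (\<Union>(A ` J) \<union> (A i - {x})) \<le> card J"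
        using viol[of x] step[of x] ixy(2) no by blast
      obtain K where K: "K \<subseteq> I - {i}" "card (\<Union>(A ` K) \<union> (A i - {y})) \<le> card K"
        using viol[of y] step[of y] ixy(3) no by blast
      let ?P = "\<Union>(A ` J) \<union> (A i - {x})" and ?Q = "\<Union>(A ` K) \<union> (A i - {y})"
      have fin: "finite ?P" "finite ?Q" "finite J" "finite K"
        using finU[of J] finU[of K] J(1) K(1) less.prems(1)[OF ixy(1)] \<open>finite I\<close>
        by (auto intro: finite_subset)
      \<comment> \<open>As \<open>x\<close> and \<open>y\<close> differ, the two deletions together
        miss nothing of \<open>A i\<close>, so the original condition applies to the index set with
        \<open>i\<close> added.\<close>
      have "?P \<union> ?Q = \<Union>(A ` insert i (J \<union> K))" using ixy by auto
      then have "card (?P \<union> ?Q) \<ge> card (insert i (J \<union> K))"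
        using less.prems(2)[of "insert i (J \<union> K)"] J(1) K(1) ixy(1)
        by (metis Diff_subset Un_least insert_subset order_trans)
      moreover have "i \<notin> J \<union> K" using J(1) K(1) by blast
      ultimately have "card (?P \<union> ?Q) \<ge> Suc (card (J \<union> K))" using fin by simp
      moreover have "card (?P \<inter> ?Q) \<ge> card (J \<inter> K)"
      proof -
        have "card (J \<inter> K) \<le> card (\<Union>(A ` (J \<inter> K)))" using less.prems(2)[of "J \<inter> K"] J(1) by blast
        also have "\<dots> \<le> card (?P \<inter> ?Q)" using fin by (intro card_mono) auto
        finally show ?thesis .
      qed
      moreover have "card (?P \<union> ?Q) + card (?P \<inter> ?Q) = card ?P + card ?Q"
        using card_Un_Int[OF fin(1,2)] by simp
      moreover have "card (J \<union> K) + card (J \<inter> K) = card J + card K"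
        using card_Un_Int[OF fin(3,4)] by simp
      ultimately show False using J(2) K(2) by linarith
    qed
  qed
qed

definition avoids :: "nat \<Rightarrow> (nat \<times> nat) set \<Rightarrow> (nat \<Rightarrow> nat) \<Rightarrow> bool" where
  "avoids n F g \<longleftrightarrow> bij_betw g {..<n} {..<n} \<and> (\<forall>i<n. (i, g i) \<notin> F)"

text \<open>An index set violating Hall's condition and the colours outside its neighbourhood span a
  grid of forbidden pairs. The colour side is trimmed so that the sizes add up to exactly
  \<open>Suc n\<close>.\<close>

lemma koenig_obstruction:
  assumes "\<nexists>g. avoids n F g"
  shows "\<exists>A B. A \<subseteq> {..<n} \<and> B \<subseteq> {..<n} \<and> A \<times> B \<subseteq> F \<and> card A + card B = Suc n"
proof -
  define N where "N i = {y. y < n \<and> (i, y) \<notin> F}" for i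
  have "\<not> (\<exists>g. (\<forall>i\<in>{..<n}. g i \<in> N i) \<and> inj_on g {..<n})"
  proof
    assume "\<exists>g. (\<forall>i\<in>{..<n}. g i \<in> N i) \<and> inj_on g {..<n}"
    then obtain g where g: "\<forall>i\<in>{..<n}. g i \<in> N i" "inj_on g {..<n}" by blast
    have "g ` {..<n} \<subseteq> {..<n}" using g(1) by (auto simp: N_def)
    then have "g ` {..<n} = {..<n}" using g(2) by (simp add: card_image card_subset_eq)
    with g assms show False by (auto simp: avoids_def bij_betw_def N_def)
  qed
  moreover have "finite (N i)" for i by (simp add: N_def)
  ultimately obtain A where A: "A \<subseteq> {..<n}" "card (\<Union>(N ` A)) < card A"
    using hall_sdr[where I = "{..<n}" and A = N] by (meson finite_lessThan not_le)
  let ?C = "{..<n} - \<Union>(N ` A)"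
  have "\<Union>(N ` A) \<subseteq> {..<n}" by (auto simp: N_def)
  then have "card ?C = n - card (\<Union>(N ` A))" by (simp add: card_Diff_subset finite_subset)
  moreover have "card A \<le> n" using card_mono[OF _ A(1)] by simp
  ultimately have "Suc n - card A \<le> card ?C" using A(2) by linarith
  then obtain B where B: "B \<subseteq> ?C" "card B = Suc n - card A"
    by (meson obtain_subset_with_card_n)
  have "A \<times> B \<subseteq> F" using A(1) B(1) by (auto simp: N_def)
  then show ?thesis using A(1) B \<open>card A \<le> n\<close> by (intro exI[of _ A] exI[of _ B]) auto
qed

section \<open>Obstructions on an 8 by 8 grid\<close>

definition partial_matching :: "('b \<times> 'c) set \<Rightarrow> bool" where
  "partial_matching M \<longleftrightarrow> single_valued M \<and> single_valued (M\<inverse>)"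

text \<open>\<open>F\<close> is read as a bipartite graph between indices and colours. Finiteness is
  demanded because \<open>card\<close> of an infinite set is 0.\<close>

definition degree_le :: "nat \<Rightarrow> (nat \<times> nat) set \<Rightarrow> bool" where
  "degree_le k F \<longleftrightarrow> finite F \<and> (\<forall>i. card (F `` {i}) \<le> k) \<and> (\<forall>y. card (F\<inverse> `` {y}) \<le> k)"

lemma partial_matching_converse [simp]: "partial_matching (M\<inverse>) \<longleftrightarrow> partial_matching M"
  by (auto simp: partial_matching_def)

lemma degree_le_converse [simp]: "degree_le k (F\<inverse>) \<longleftrightarrow> degree_le k F"
  by (auto simp: degree_le_def)

text \<open>Five columns are covered by at most four entries of \<open>F\<close> and at most one of
  \<open>M\<close>, so both bounds are attained.\<close>

lemma tight_row:
  assumes "degree_le 4 F" "partial_matching M" "A \<times> B \<subseteq> F \<union> M" "card B = 5" "i \<in> A"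
  shows "\<exists>y\<in>B. (i, y) \<in> M \<and> F `` {i} = B - {y}"
proof -
  have finB: "finite B" using assms(4) by (simp add: card_ge_0_finite)
  have finF: "finite (F `` {i})" using assms(1) by (simp add: degree_le_def finite_Image)
  have "\<not> B \<subseteq> F `` {i}"
  proof
    assume "B \<subseteq> F `` {i}"
    then have "5 \<le> card (F `` {i})" using card_mono[OF finF] assms(4) by metis
    moreover have "card (F `` {i}) \<le> 4" using assms(1) by (auto simp: degree_le_def)
    ultimately show False by simp
  qed
  then obtain y where y: "y \<in> B" "(i, y) \<notin> F" by blast
  then have M: "(i, y) \<in> M" using assms(3,5) by blast
  have "B - {y} \<subseteq> F `` {i}"
  proof
    fix z assume z: "z \<in> B - {y}"
    then have "(i, z) \<notin> M" using M assms(2) by (auto simp: partial_matching_def dest: single_valuedD)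
    with z assms(3,5) show "z \<in> F `` {i}" by blast
  qed
  moreover have "card (F `` {i}) \<le> card (B - {y})"
    using assms(1,4) y(1) by (simp add: degree_le_def)
  ultimately have "B - {y} = F `` {i}" using card_seteq[OF finF] by blast
  with y(1) M show ?thesis by blast
qed

text \<open>The weaker substitute for \<open>tight_row\<close> when the grid has only four columns
  and counting forces no equality: \<open>M\<close> supplies at most one entry of the row.\<close>

lemma near_row:
  assumes "partial_matching M" "A \<times> B \<subseteq> F \<union> M" "i \<in> A"
  shows "\<exists>y. B - {y} \<subseteq> F `` {i}"
proof (cases "\<exists>y\<in>B. (i, y) \<in> M")
  case True
  then obtain y where y: "(i, y) \<in> M" by blast
  have "B - {y} \<subseteq> F `` {i}"
  proof
    fix z assume z: "z \<in> B - {y}"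
    then have "(i, z) \<notin> M"
      using y assms(1) by (auto simp: partial_matching_def dest: single_valuedD)
    with z assms(2,3) show "z \<in> F `` {i}" by blast
  qed
  then show ?thesis by blast
next
  case False
  then show ?thesis using assms by blast
qed

lemma near_column:
  assumes "partial_matching M" "A \<times> B \<subseteq> F \<union> M" "y \<in> B"
  shows "\<exists>x. A - {x} \<subseteq> F\<inverse> `` {y}"
proof -
  have "B \<times> A \<subseteq> F\<inverse> \<union> M\<inverse>" using assms(2) by blast
  then show ?thesis using near_row[of "M\<inverse>" B A "F\<inverse>" y] assms(1,3) by simp
qed

section \<open>Comparing two obstructions over the same fixed relation\<close>

text \<open>\<open>F\<close> nearly determines a 4 by 5 grid: the column sets coincide, and the row
  sets share at least three rows. In a common row \<open>M\<close> and \<open>M'\<close> must fill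
  the same single gap of \<open>F\<close>.\<close>

lemma two_obstructions_same_shape:
  assumes F: "degree_le 4 F" and M: "partial_matching M" "partial_matching M'" "finite M"
    and AB: "A \<subseteq> {..<8}" "B \<subseteq> {..<8}" "A \<times> B \<subseteq> F \<union> M" "card A = 4" "card B = 5"
    and AB': "A' \<subseteq> {..<8}" "B' \<subseteq> {..<8}" "A' \<times> B' \<subseteq> F \<union> M'" "card A' = 4" "card B' = 5"
  shows "3 \<le> card (M \<inter> M' \<inter> A \<times> B)"
proof -
  have fin: "finite A" "finite B" "finite A'" "finite B'"
    using AB AB' finite_subset[OF _ finite_lessThan] by blast+
  obtain m where m: "\<And>i. i \<in> A \<Longrightarrow> m i \<in> B \<and> (i, m i) \<in> M \<and> F `` {i} = B - {m i}"
    using tight_row[OF F M(1) AB(3,5)] by metis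
  obtain m' where m': "\<And>i. i \<in> A' \<Longrightarrow> m' i \<in> B' \<and> (i, m' i) \<in> M' \<and> F `` {i} = B' - {m' i}"
    using tight_row[OF F M(2) AB'(3,5)] by metis
  have inj: "inj_on m A"
    using m M(1) unfolding partial_matching_def single_valued_def inj_on_def by (metis converse_iff)
  have finF: "finite (F\<inverse> `` {y})" "card (F\<inverse> `` {y}) \<le> 4" for y
    using F by (auto simp: degree_le_def finite_Image)
  \<comment> \<open>Two 5-sets among 8 columns meet.\<close>
  have "B \<inter> B' \<noteq> {}"
  proof
    assume "B \<inter> B' = {}"
    then have "card (B \<union> B') = 10" using card_Un_disjoint[OF fin(2,4)] AB(5) AB'(5) by simp
    moreover have "card (B \<union> B') \<le> card {..<8::nat}" using AB(2) AB'(2) by (intro card_mono) auto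
    ultimately show False by simp
  qed
  then obtain y where y: "y \<in> B" "y \<in> B'" by blast
  obtain x x' where x: "A - {x} \<subseteq> F\<inverse> `` {y}" "A' - {x'} \<subseteq> F\<inverse> `` {y}"
    using near_column[OF M(1) AB(3) y(1)] near_column[OF M(2) AB'(3) y(2)] by blast
  \<comment> \<open>Column \<open>y\<close> of \<open>F\<close> has at most four entries and covers
    each of \<open>A\<close>, \<open>A'\<close> up to one row, so the union has at most six rows and
    two rows are common.\<close>
  have "A \<union> A' \<subseteq> F\<inverse> `` {y} \<union> {x, x'}" using x by blast
  then have "card (A \<union> A') \<le> card (F\<inverse> `` {y} \<union> {x, x'})" using finF by (intro card_mono) auto
  also have "\<dots> \<le> 4 + 2"
    using card_Un_le[of "F\<inverse> `` {y}" "{x, x'}"] finF(2)[of y] card_insert_le_m1[of 2 "{x'}" x]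
    by simp
  finally have "2 \<le> card (A \<inter> A')" using card_Un_Int[OF fin(1,3)] AB(4) AB'(4) by simp
  then obtain i j where ij: "i \<in> A" "i \<in> A'" "j \<in> A" "j \<in> A'" "i \<noteq> j"
    by (metis IntE card_le_Suc0_iff_eq fin(1) finite_Int not_less_eq_eq numeral_2_eq_2)
  have "m i \<noteq> m j" using inj ij by (meson inj_onD)
  \<comment> \<open>Row \<open>i\<close> of \<open>F\<close> is \<open>B\<close> without
    \<open>m i\<close>; two rows with different gaps exhaust \<open>B\<close>, and both rows lie in
    \<open>B'\<close>.\<close>
  then have "B \<subseteq> B'" using m[of i] m'[of i] m[of j] m'[of j] ij by blast
  then have BB: "B = B'" using card_subset_eq[OF fin(4)] AB(5) AB'(5) by simp
  have "card (m ` A) < card B" using card_image_le[OF fin(1), of m] AB(4,5) by simp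
  then have "\<not> B \<subseteq> m ` A" using fin(1) by (meson card_mono finite_imageI not_le)
  \<comment> \<open>Four rows leave four gaps in five columns, so some column \<open>z\<close> has
    no gap. Its four entries in \<open>F\<close> then make up the whole column, which recovers
    \<open>A\<close> from \<open>F\<close>.\<close>
  then obtain z where z: "z \<in> B" "z \<notin> m ` A" by blast
  have "A \<subseteq> F\<inverse> `` {z}" using m z by blast
  then have col: "A = F\<inverse> `` {z}" using card_seteq[OF finF(1), of A z] finF(2)[of z] AB(4) by simp
  obtain w where w: "A' - {w} \<subseteq> F\<inverse> `` {z}" using near_column[OF M(2) AB'(3)] z BB by blast
  have "card A' \<le> Suc (card (A' - {w}))" using AB'(4) by (simp add: card_Diff_singleton_if)
  also have "card (A' - {w}) \<le> card (A \<inter> A')" using w col fin by (intro card_mono) auto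
  finally have three: "3 \<le> card (A \<inter> A')" using AB'(4) by simp
  have "(i, m i) \<in> M \<inter> M' \<inter> A \<times> B" if i: "i \<in> A" "i \<in> A'" for i
  proof -
    have "m i = m' i" using m[OF i(1)] m'[OF i(2)] BB by blast
    then show ?thesis using m[OF i(1)] m'[OF i(2)] i by auto
  qed
  then have "(\<lambda>i. (i, m i)) ` (A \<inter> A') \<subseteq> M \<inter> M' \<inter> A \<times> B" by blast
  then have "card ((\<lambda>i. (i, m i)) ` (A \<inter> A')) \<le> card (M \<inter> M' \<inter> A \<times> B)"
    using M(3) by (intro card_mono) auto
  moreover have "card ((\<lambda>i. (i, m i)) ` (A \<inter> A')) = card (A \<inter> A')"
    by (intro card_image) (auto simp: inj_on_def)
  ultimately show ?thesis using three by simp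
qed

text \<open>Here the grids turn out to be nested, \<open>B'\<close> inside \<open>B\<close> and
  \<open>A\<close> inside \<open>A'\<close>. All but at most one entry of \<open>M\<close> in the
  first grid then lie in the second grid and outside \<open>F\<close>, hence in
  \<open>M'\<close>.\<close>

lemma two_obstructions_opposite_shape:
  assumes F: "degree_le 4 F" and M: "partial_matching M" "partial_matching M'" "finite M"
    and AB: "A \<subseteq> {..<8}" "B \<subseteq> {..<8}" "A \<times> B \<subseteq> F \<union> M" "card A = 4" "card B = 5"
    and AB': "A' \<subseteq> {..<8}" "B' \<subseteq> {..<8}" "A' \<times> B' \<subseteq> F \<union> M'" "card A' = 5" "card B' = 4"
  shows "3 \<le> card (M \<inter> M' \<inter> A \<times> B)"
proof -
  have fin: "finite A" "finite B" "finite A'" "finite B'"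
    using AB AB' finite_subset[OF _ finite_lessThan] by blast+
  obtain m where m: "\<And>i. i \<in> A \<Longrightarrow> m i \<in> B \<and> (i, m i) \<in> M \<and> F `` {i} = B - {m i}"
    using tight_row[OF F M(1) AB(3,5)] by metis
  have "\<exists>x\<in>A'. (y, x) \<in> M'\<inverse> \<and> F\<inverse> `` {y} = A' - {x}" if "y \<in> B'" for y
    using tight_row[of "F\<inverse>" "M'\<inverse>" B' A' y] F M(2) AB'(3,4) that by auto
  then obtain m' where m': "\<And>y. y \<in> B' \<Longrightarrow> m' y \<in> A' \<and> (m' y, y) \<in> M' \<and> F\<inverse> `` {y} = A' - {m' y}"
    by (metis converse_iff)
  have inj: "inj_on m A"
    using m M(1) unfolding partial_matching_def single_valued_def inj_on_def by (metis converse_iff)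
  have meet: "X \<inter> Y \<noteq> {}" if "X \<subseteq> {..<8::nat}" "Y \<subseteq> {..<8}" "card X + card Y = 9" for X Y
  proof
    assume "X \<inter> Y = {}"
    then have "card (X \<union> Y) = 9" using card_Un_disjoint that finite_subset[OF _ finite_lessThan] by metis
    moreover have "card (X \<union> Y) \<le> card {..<8::nat}" using that by (intro card_mono) auto
    ultimately show False by simp
  qed
  have two: "\<exists>a\<in>X. \<exists>b\<in>X. a \<noteq> b" if "Y - {c} \<subseteq> X" "card Y = 4" "finite X" for X Y and c :: nat
  proof -
    have "3 \<le> card (Y - {c})" using that(2) by (simp add: card_Diff_singleton_if)
    also have "\<dots> \<le> card X" using that by (intro card_mono) auto
    finally have "\<not> card X \<le> Suc 0" by simp
    then show ?thesis using card_le_Suc0_iff_eq[OF that(3)] by blast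
  qed
  obtain i0 where i0: "i0 \<in> A" "i0 \<in> A'" using meet[of A A'] AB AB' by auto
  obtain y0 where y0: "y0 \<in> B" "y0 \<in> B'" using meet[of B B'] AB AB' by auto
  obtain c where "B' - {c} \<subseteq> F `` {i0}" using near_row[OF M(2) AB'(3) i0(2)] by blast
  then have "B' - {c} \<subseteq> B \<inter> B'" using m[OF i0(1)] by blast
  then obtain y z where yz: "y \<in> B" "y \<in> B'" "z \<in> B" "z \<in> B'" "y \<noteq> z"
    using two AB'(5) fin by (meson IntE finite_Int)
  obtain d where "A - {d} \<subseteq> F\<inverse> `` {y0}" using near_column[OF M(1) AB(3) y0(1)] by blast
  then have "A - {d} \<subseteq> A \<inter> A'" using m'[OF y0(2)] by blast
  then obtain i j where ij: "i \<in> A" "i \<in> A'" "j \<in> A" "j \<in> A'" "i \<noteq> j"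
    using two AB(4) fin by (meson IntE finite_Int)
  \<comment> \<open>In two common rows \<open>F\<close> stays inside \<open>B\<close>, so a column
    of \<open>B'\<close> outside \<open>B\<close> would need two entries of the matching
    \<open>M'\<close>. The inclusion of \<open>A\<close> in \<open>A'\<close> is the transposed
    argument.\<close>
  have BB: "B' \<subseteq> B"
  proof (rule ccontr)
    assume "\<not> B' \<subseteq> B"
    then obtain b where b: "b \<in> B'" "b \<notin> B" by blast
    then have "(i, b) \<in> M'" "(j, b) \<in> M'" using AB'(3) m[of i] m[of j] ij by blast+
    then show False using M(2) ij(5) unfolding partial_matching_def single_valued_def by blast
  qed
  have AA: "A \<subseteq> A'"
  proof (rule ccontr)
    assume "\<not> A \<subseteq> A'"
    then obtain a where a: "a \<in> A" "a \<notin> A'" by blast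
    then have "(a, y) \<in> M" "(a, z) \<in> M" using AB(3) m'[of y] m'[of z] yz by blast+
    then show False using M(1) yz(5) unfolding partial_matching_def single_valued_def by blast
  qed
  \<comment> \<open>\<open>B\<close> has just one column outside \<open>B'\<close>, so by
    injectivity of \<open>m\<close> at most one of the four rows is lost.\<close>
  let ?X = "{i\<in>A. m i \<in> B'}"
  have "m ` (A - ?X) \<subseteq> B - B'" using m by auto
  then have "card (m ` (A - ?X)) \<le> card (B - B')" using fin by (intro card_mono) auto
  moreover have "card (B - B') = 1" using BB fin AB(5) AB'(5) by (simp add: card_Diff_subset)
  moreover have "card (m ` (A - ?X)) = card (A - ?X)"
    by (intro card_image inj_on_subset[OF inj]) auto
  moreover have "card (A - ?X) = 4 - card ?X" using AB(4) fin by (subst card_Diff_subset) auto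
  ultimately have three: "3 \<le> card ?X" by linarith
  have "(\<lambda>i. (i, m i)) ` ?X \<subseteq> M \<inter> M' \<inter> A \<times> B"
    using m AA AB'(3) by blast
  then have "card ((\<lambda>i. (i, m i)) ` ?X) \<le> card (M \<inter> M' \<inter> A \<times> B)"
    using M(3) by (intro card_mono) auto
  moreover have "card ((\<lambda>i. (i, m i)) ` ?X) = card ?X"
    by (intro card_image) (auto simp: inj_on_def)
  ultimately show ?thesis using three by simp
qed

text \<open>The grid of \<open>koenig_obstruction\<close> for \<open>n = 8\<close>.\<close>

definition obstruction :: "(nat \<times> nat) set \<Rightarrow> nat set \<Rightarrow> nat set \<Rightarrow> bool" where
  "obstruction F A B \<longleftrightarrow> A \<subseteq> {..<8} \<and> B \<subseteq> {..<8} \<and> A \<times> B \<subseteq> F \<and> card A + card B = 9"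

lemma obstruction_exists:
  "\<nexists>g. avoids 8 F g \<Longrightarrow> \<exists>A B. obstruction F A B"
  using koenig_obstruction[of 8 F] by (auto simp: obstruction_def)

text \<open>Each side of the grid lies in a single row or column of \<open>F\<close>. Both sides are
  non-empty because neither exceeds 8 while the sum is 9.\<close>

lemma obstruction_card_le:
  assumes "obstruction F A B" "degree_le k F" "k < 9"
  shows "card A \<le> k" "card B \<le> k"
proof -
  have le8: "card A \<le> 8" "card B \<le> 8"
    using card_mono[of "{..<8::nat}" A] card_mono[of "{..<8::nat}" B] assms(1)
    by (auto simp: obstruction_def)
  then have "A \<noteq> {}" "B \<noteq> {}" using assms(1) by (auto simp: obstruction_def)
  then obtain i y where "i \<in> A" "y \<in> B" by blast
  then have sub: "A \<subseteq> F\<inverse> `` {y}" "B \<subseteq> F `` {i}" using assms(1) by (auto simp: obstruction_def)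
  have fin: "finite (F\<inverse> `` {y})" "finite (F `` {i})" using assms(2) by (auto simp: degree_le_def finite_Image)
  show "card A \<le> k" "card B \<le> k"
    using card_mono[OF fin(1) sub(1)] card_mono[OF fin(2) sub(2)] assms(2)
    by (auto simp: degree_le_def intro: order_trans)
qed

lemma avoids_exists_degree_4:
  assumes "degree_le 4 F" shows "\<exists>g. avoids 8 F g"
proof (rule ccontr)
  assume "\<nexists>g. avoids 8 F g"
  then obtain A B where "obstruction F A B" using obstruction_exists by blast
  with obstruction_card_le[OF this assms] show False by (simp add: obstruction_def)
qed

lemma degree_le_Un_matching:
  assumes "degree_le k F" "partial_matching M" "finite M"
  shows "degree_le (Suc k) (F \<union> M)"
proof -
  have one: "card (R `` {i}) \<le> 1" if "single_valued R" for i and R :: "(nat \<times> nat) set"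
  proof -
    have "R `` {i} \<subseteq> {SOME y. (i, y) \<in> R}"
      using that by (auto simp: single_valued_def intro: someI2)
    then show ?thesis using card_mono[of "{SOME y. (i, y) \<in> R}" "R `` {i}"] by simp
  qed
  have "card ((F \<union> M) `` {i}) \<le> Suc k" for i
  proof -
    have "card ((F \<union> M) `` {i}) \<le> card (F `` {i}) + card (M `` {i})" by (simp add: Un_Image card_Un_le)
    moreover have "card (F `` {i}) \<le> k" using assms(1) by (simp add: degree_le_def)
    moreover have "card (M `` {i}) \<le> 1" using one assms(2) by (simp add: partial_matching_def)
    ultimately show ?thesis by linarith
  qed
  moreover have "card ((F \<union> M)\<inverse> `` {i}) \<le> Suc k" for i
  proof -
    have "card ((F \<union> M)\<inverse> `` {i}) \<le> card (F\<inverse> `` {i}) + card (M\<inverse> `` {i})"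
      by (simp add: converse_Un Un_Image card_Un_le)
    moreover have "card (F\<inverse> `` {i}) \<le> k" using assms(1) by (simp add: degree_le_def)
    moreover have "card (M\<inverse> `` {i}) \<le> 1" using one[of "M\<inverse>"] assms(2) by (simp add: partial_matching_def)
    ultimately show ?thesis by linarith
  qed
  ultimately show ?thesis using assms by (simp add: degree_le_def)
qed

text \<open>With degrees at most 5 and sides adding up to 9, only the shapes 4 by 5 and 5 by 4
  remain. Transposition reduces the four combinations to the two treated above.\<close>

lemma two_obstructions:
  assumes F: "degree_le 4 F" and M: "partial_matching M" "partial_matching M'" "finite M" "finite M'"
    and "obstruction (F \<union> M) A B" "obstruction (F \<union> M') A' B'"
  shows "3 \<le> card (M \<inter> M' \<inter> A \<times> B)"
proof -
  have shape: "card A = 4 \<and> card B = 5 \<or> card A = 5 \<and> card B = 4"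
    if "obstruction (F \<union> M) A B" "partial_matching M" "finite M" for M A B
    using obstruction_card_le[OF that(1) degree_le_Un_matching[OF F that(2,3)]] that(1)
    by (auto simp: obstruction_def)
  have conv: "card (M \<inter> M' \<inter> A \<times> B) = card (M\<inverse> \<inter> M'\<inverse> \<inter> B \<times> A)"
    using card_inverse[of "M \<inter> M' \<inter> A \<times> B"] by (simp add: converse_Int converse_Times Int_assoc)
  note O = assms(6,7)[unfolded obstruction_def]
  have F': "degree_le 4 (F\<inverse>)" and M': "partial_matching (M\<inverse>)" "partial_matching (M'\<inverse>)" "finite (M\<inverse>)"
    using F M by auto
  have O': "B \<times> A \<subseteq> F\<inverse> \<union> M\<inverse>" "B' \<times> A' \<subseteq> F\<inverse> \<union> M'\<inverse>" using O by auto
  from shape[OF assms(6) M(1,3)] shape[OF assms(7) M(2,4)] show ?thesis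
  proof (elim disjE conjE)
    assume "card A = 4" "card B = 5" "card A' = 4" "card B' = 5"
    then show ?thesis using two_obstructions_same_shape[OF F M(1-3)] O by blast
  next
    assume "card A = 4" "card B = 5" "card A' = 5" "card B' = 4"
    then show ?thesis using two_obstructions_opposite_shape[OF F M(1-3)] O by blast
  next
    assume "card A = 5" "card B = 4" "card A' = 4" "card B' = 5"
    then show ?thesis unfolding conv using two_obstructions_opposite_shape[OF F' M'] O O' by blast
  next
    assume "card A = 5" "card B = 4" "card A' = 5" "card B' = 4"
    then show ?thesis unfolding conv using two_obstructions_same_shape[OF F' M'] O O' by blast
  qed
qed

section \<open>Rerouting a perfect matching\<close>

text \<open>Applied to the converse relation it describes in-closed sets.\<close>

definition out_closed :: "('b \<times> 'b) set \<Rightarrow> 'b set \<Rightarrow> bool" where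
  "out_closed R K \<longleftrightarrow> (\<forall>i\<in>K. \<forall>j. (i, j) \<in> R \<longrightarrow> j \<in> K)"

lemma minimal_closed_subset:
  assumes "finite K0" "K0 \<noteq> {}" "out_closed R K0"
  obtains K where "K \<subseteq> K0" "K \<noteq> {}" "out_closed R K"
    "\<And>K'. K' \<subset> K \<Longrightarrow> out_closed R K' \<Longrightarrow> K' = {}"
proof -
  let ?S = "{K. K \<subseteq> K0 \<and> K \<noteq> {} \<and> out_closed R K}"
  have "finite ?S" using assms(1) by (auto intro: finite_subset[of _ "Pow K0"])
  moreover have "K0 \<in> ?S" using assms by simp
  ultimately obtain K where K: "K \<in> ?S" "\<And>K'. K' \<in> ?S \<Longrightarrow> K' \<le> K \<Longrightarrow> K' = K"
    using finite_has_minimal2[of ?S K0] by (metis (no_types, lifting))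
  show ?thesis
  proof
    show "K \<subseteq> K0" "K \<noteq> {}" "out_closed R K" using K(1) by auto
    fix K' assume "K' \<subset> K" "out_closed R K'"
    then show "K' = {}" using K by auto
  qed
qed

text \<open>A minimal out-closed set, a minimal in-closed subset of its complement, and L are pairwise
  disjoint, and each has at least 3 of the 8 vertices.\<close>

lemma three_transient_vertices:
  fixes R :: "(nat \<times> nat) set"
  assumes R: "R \<subseteq> {..<8} \<times> {..<8}"
    and out3: "\<And>K. K \<subseteq> {..<8} \<Longrightarrow> K \<noteq> {} \<Longrightarrow> out_closed R K \<Longrightarrow> 3 \<le> card K"
    and in3: "\<And>K. K \<subseteq> {..<8} \<Longrightarrow> K \<noteq> {} \<Longrightarrow> out_closed (R\<inverse>) K \<Longrightarrow> 3 \<le> card K"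
    and L: "L \<subseteq> {..<8}" "card L = 3"
    and trans: "\<And>l. l \<in> L \<Longrightarrow> \<exists>K. out_closed R K \<and> l \<notin> K \<and> R `` {l} \<subseteq> K"
    and nonempty: "\<And>l. l \<in> L \<Longrightarrow> R `` {l} \<noteq> {}" "\<And>l. l \<in> L \<Longrightarrow> R\<inverse> `` {l} \<noteq> {}"
  shows False
proof -
  have "out_closed R {..<8}" using R by (auto simp: out_closed_def)
  moreover have "{..<8::nat} \<noteq> {}" by (auto simp: lessThan_empty_iff)
  ultimately obtain K where K: "K \<subseteq> {..<8}" "K \<noteq> {}" "out_closed R K"
    "\<And>K'. K' \<subset> K \<Longrightarrow> out_closed R K' \<Longrightarrow> K' = {}"
    using minimal_closed_subset[of "{..<8}" R] by (metis finite_lessThan)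
  \<comment> \<open>Otherwise \<open>K \<inter> C\<close> is a smaller closed set, hence empty,
    although it contains the successors of \<open>l\<close>.\<close>
  have KL: "l \<notin> K" if l: "l \<in> L" for l
  proof
    assume "l \<in> K"
    obtain C where C: "out_closed R C" "l \<notin> C" "R `` {l} \<subseteq> C" using trans[OF l] by blast
    have "out_closed R (K \<inter> C)" using C K(3) by (auto simp: out_closed_def)
    moreover have "K \<inter> C \<subset> K" using \<open>l \<in> K\<close> C(2) by blast
    ultimately have "K \<inter> C = {}" using K(4) by blast
    then show False using nonempty(1)[OF l] C(3) K(3) \<open>l \<in> K\<close> by (auto simp: out_closed_def)
  qed
  let ?D = "{..<8} - K"
  have "out_closed (R\<inverse>) ?D" using R K(3) by (auto simp: out_closed_def)
  moreover have "?D \<noteq> {}"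
  proof -
    obtain l where "l \<in> L" using L(2) by fastforce
    then show ?thesis using KL L(1) by blast
  qed
  ultimately obtain J where J: "J \<subseteq> ?D" "J \<noteq> {}" "out_closed (R\<inverse>) J"
    "\<And>K'. K' \<subset> J \<Longrightarrow> out_closed (R\<inverse>) K' \<Longrightarrow> K' = {}"
    using minimal_closed_subset[of ?D "R\<inverse>"] by (metis finite_Diff finite_lessThan)
  have JL: "l \<notin> J" if l: "l \<in> L" for l
  proof
    assume "l \<in> J"
    obtain C where C: "out_closed R C" "l \<notin> C" "R `` {l} \<subseteq> C" using trans[OF l] by blast
    \<comment> \<open>This complement is closed under predecessors, since successors of
      \<open>l\<close> and of elements of \<open>C\<close> lie in \<open>C\<close>. It also contains
      every predecessor of \<open>l\<close>, which contradicts minimality of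
      \<open>J\<close>.\<close>
    let ?C = "- insert l C"
    have "out_closed (R\<inverse>) (J \<inter> ?C)"
      unfolding out_closed_def
    proof (intro ballI allI impI)
      fix x w assume xw: "x \<in> J \<inter> ?C" "(x, w) \<in> R\<inverse>"
      then have "w \<in> J" using J(3) by (auto simp: out_closed_def)
      moreover have "w \<noteq> l" using xw C(3) by auto
      moreover have "w \<notin> C" using xw C(1) by (auto simp: out_closed_def)
      ultimately show "w \<in> J \<inter> ?C" by simp
    qed
    moreover have "J \<inter> ?C \<subset> J" using \<open>l \<in> J\<close> by blast
    ultimately have empty: "J \<inter> ?C = {}" using J(4) by blast
    obtain w where w: "(w, l) \<in> R" using nonempty(2)[OF l] by blast
    then have "w \<in> J" using J(3) \<open>l \<in> J\<close> by (auto simp: out_closed_def)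
    moreover have "w \<notin> C" using w C(1,2) by (auto simp: out_closed_def)
    moreover have "w \<noteq> l" using w C(2,3) by auto
    ultimately show False using empty by blast
  qed
  have fin: "finite K" "finite J" "finite L"
    using K(1) J(1) L(1) by (auto intro: finite_subset[OF _ finite_lessThan[of 8]])
  have "card (K \<union> J \<union> L) = card K + card J + card L"
    using fin J(1) KL JL by (subst card_Un_disjoint; (subst card_Un_disjoint)?) auto
  moreover have "card (K \<union> J \<union> L) \<le> card {..<8::nat}"
    using K(1) J(1) L(1) by (intro card_mono) auto
  moreover have "3 \<le> card K" "3 \<le> card J"
    using out3[OF K(1-3)] in3[of J] J by auto
  ultimately show False using L(2) by simp
qed

text \<open>Contracting the edges of M turns G into a digraph, in which l lies on no cycle if every
  perfect matching uses the edge (l, M l). The excluded edge e lets the lemma be applied a second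
  time without undoing the first change.\<close>

lemma reroute_one:
  fixes G :: "(nat \<times> nat) set"
  assumes G: "G \<subseteq> {..<8} \<times> {..<8}"
    and row: "\<And>i. i < 8 \<Longrightarrow> 3 \<le> card (G `` {i})"
    and col: "\<And>y. y < 8 \<Longrightarrow> 3 \<le> card (G\<inverse> `` {y})"
    and M: "avoids 8 (- (G - {e})) M"
    and L: "L \<subseteq> {..<8}" "card L = 3"
  shows "\<exists>M' l. avoids 8 (- (G - {e})) M' \<and> l \<in> L \<and> M' l \<noteq> M l"
proof (rule ccontr)
  assume no: "\<not> ?thesis"
  have bij: "bij_betw M {..<8} {..<8}" and MG: "\<And>i. i < 8 \<Longrightarrow> (i, M i) \<in> G - {e}"
    using M by (auto simp: avoids_def)
  have inj: "inj_on M {..<8}" and im: "M ` {..<8} = {..<8}" using bij by (auto simp: bij_betw_def)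
  have M8: "M i < 8" if "i < 8" for i using im that by blast
  have onto: "\<exists>i<8. y = M i" if "y < 8" for y using im that by (metis imageE lessThan_iff)
  \<comment> \<open>Vertex \<open>i\<close> stands for the contracted edge \<open>(i, M i)\<close>,
    and cycles of \<open>R\<close> are the alternating cycles of \<open>M\<close>. Row
    \<open>i\<close> of \<open>G\<close> consists of \<open>M i\<close>, the images of the
    successors of \<open>i\<close>, and possibly the excluded edge \<open>e\<close>.\<close>
  define R where "R = {(i, j). i < 8 \<and> j < 8 \<and> i \<noteq> j \<and> (i, M j) \<in> G - {e}}"
  have finG: "finite (G `` {i})" "finite (G\<inverse> `` {i})" for i
    using finite_subset[OF G] by (auto simp: finite_Image)
  have row_sub: "G `` {i} \<subseteq> insert (M i) (M ` (R `` {i})) \<union> {y. e = (i, y)}" if "i < 8" for i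
  proof
    fix y assume y: "y \<in> G `` {i}"
    then have "y < 8" using G by auto
    then obtain j where "j < 8" "y = M j" using onto by blast
    then show "y \<in> insert (M i) (M ` (R `` {i})) \<union> {y. e = (i, y)}"
      using y that by (cases "i = j") (auto simp: R_def)
  qed
  have col_sub: "G\<inverse> `` {M j} \<subseteq> insert j (R\<inverse> `` {j}) \<union> {x. e = (x, M j)}" if "j < 8" for j
    using G that by (auto simp: R_def)
  have one: "card {y. e = (i, y)} \<le> 1" "finite {y. e = (i, y)}"
    "card {x. e = (x, i)} \<le> 1" "finite {x. e = (x, i)}" for i
    by (cases e; auto simp: card_le_Suc0_iff_eq)+
  have finR: "finite (R `` {i})" "finite (R\<inverse> `` {i})" for i
    by (rule finite_subset[of _ "{..<8}"]; auto simp: R_def)+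
  have row_bound: "3 \<le> card (insert (M i) (M ` (R `` {i})) \<union> {y. e = (i, y)})" if "i < 8" for i
    using card_mono[OF _ row_sub[OF that]] row[OF that] finR one by (meson finite.insertI finite_UnI finite_imageI order_trans)
  have col_bound: "3 \<le> card (insert i (R\<inverse> `` {i}) \<union> {x. e = (x, M i)})" if "i < 8" for i
    using card_mono[OF _ col_sub[OF that]] col[OF M8[OF that]] finR one by (meson finite.insertI finite_UnI order_trans)
  have L8: "l < 8" if "l \<in> L" for l using that L(1) by auto
  show False
  proof (rule three_transient_vertices[of R L])
    show "R \<subseteq> {..<8} \<times> {..<8}" by (auto simp: R_def)
    show "L \<subseteq> {..<8}" "card L = 3" by (fact L)+
    show "R `` {l} \<noteq> {}" if "l \<in> L" for l
    proof
      assume "R `` {l} = {}"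
      then show False
        using row_bound[OF L8[OF that]] card_Un_le[of "{M l}" "{y. e = (l, y)}"] one(1)[of l] by simp
    qed
    show "R\<inverse> `` {l} \<noteq> {}" if "l \<in> L" for l
    proof
      assume "R\<inverse> `` {l} = {}"
      then show False
        using col_bound[OF L8[OF that]] card_Un_le[of "{l}" "{x. e = (x, M l)}"] one(3)[of "M l"] by simp
    qed
    show "3 \<le> card K" if K: "K \<subseteq> {..<8}" "K \<noteq> {}" "out_closed R K" for K
    proof -
      have finK: "finite K" using K(1) by (rule finite_subset) simp
      have sub: "insert (M i) (M ` (R `` {i})) \<subseteq> M ` K" if "i \<in> K" for i
        using K(3) that by (auto simp: out_closed_def)
      show ?thesis
      proof (cases "\<exists>i\<in>K. i \<noteq> fst e")
        case True
        then obtain i where i: "i \<in> K" "i \<noteq> fst e" by blast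
        then have "{y. e = (i, y)} = {}" by auto
        then have "3 \<le> card (insert (M i) (M ` (R `` {i})))" using row_bound[of i] i K(1) by auto
        also have "\<dots> \<le> card (M ` K)" using sub[OF i(1)] finK by (intro card_mono) auto
        also have "\<dots> \<le> card K" using finK by (rule card_image_le)
        finally show ?thesis .
      next
        case False
        \<comment> \<open>A set with no vertex other than \<open>fst e\<close> would leave that row
          only its \<open>M\<close>-edge and \<open>e\<close>, two entries instead of three.\<close>
        then have "K \<subseteq> {fst e}" by auto
        then have Ke: "K = {fst e}" using K(2) by (simp add: subset_singleton_iff)
        then have only: "insert (M (fst e)) (M ` (R `` {fst e})) = {M (fst e)}" using sub[of "fst e"] by auto
        have False
          using row_bound[of "fst e", unfolded only] Ke K(1) card_Un_le[of "{M (fst e)}" "{y. e = (fst e, y)}"] one(1)[of "fst e"]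
          by simp
        then show ?thesis ..
      qed
    qed
    show "3 \<le> card K" if K: "K \<subseteq> {..<8}" "K \<noteq> {}" "out_closed (R\<inverse>) K" for K
    proof -
      have finK: "finite K" using K(1) by (rule finite_subset) simp
      have sub: "insert i (R\<inverse> `` {i}) \<subseteq> K" if "i \<in> K" for i
        using K(3) that by (auto simp: out_closed_def)
      show ?thesis
      proof (cases "\<exists>i\<in>K. M i \<noteq> snd e")
        case True
        then obtain i where i: "i \<in> K" "M i \<noteq> snd e" by blast
        then have "{x. e = (x, M i)} = {}" by auto
        then have "3 \<le> card (insert i (R\<inverse> `` {i}))" using col_bound[of i] i K(1) by auto
        also have "\<dots> \<le> card K" using sub[OF i(1)] finK by (intro card_mono) auto
        finally show ?thesis .
      next
        case False
        obtain i where i: "i \<in> K" using K(2) by blast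
        have "x = i" if "x \<in> K" for x
        proof -
          have "M x = M i" using False that i by metis
          moreover have "x \<in> {..<8}" "i \<in> {..<8}" using that i K(1) by blast+
          ultimately show ?thesis by (rule inj_onD[OF inj])
        qed
        then have "K = {i}" using i by blast
        then have only: "insert i (R\<inverse> `` {i}) = {i}" using sub[OF i] by auto
        have False
          using col_bound[of i, unfolded only] i K(1) card_Un_le[of "{i}" "{x. e = (x, M i)}"] one(3)[of "M i"]
          by auto
        then show ?thesis ..
      qed
    qed
    show "\<exists>K. out_closed R K \<and> l \<notin> K \<and> R `` {l} \<subseteq> K" if l: "l \<in> L" for l
    proof -
      \<comment> \<open>No perfect matching drops \<open>(l, M l)\<close>, so a grid
        \<open>A\<close>, \<open>B\<close> blocks the graph without that edge;
        \<open>A - {l}\<close> will be the closed set.\<close>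
      have "\<nexists>g. avoids 8 (- (G - {e} - {(l, M l)})) g"
      proof
        assume "\<exists>g. avoids 8 (- (G - {e} - {(l, M l)})) g"
        then obtain g where g: "avoids 8 (- (G - {e} - {(l, M l)})) g" by blast
        then have "avoids 8 (- (G - {e})) g" "g l \<noteq> M l" using L8[OF l] by (auto simp: avoids_def)
        with no l show False by blast
      qed
      then obtain A B where AB: "A \<subseteq> {..<8}" "B \<subseteq> {..<8}" "card A + card B = 9"
        "A \<times> B \<subseteq> - (G - {e} - {(l, M l)})"
        using obstruction_exists unfolding obstruction_def by meson
      have fin: "finite A" "finite B" using AB(1,2) by (auto intro: finite_subset)
      have cMA: "card (M ` A) = card A" using inj AB(1) by (meson card_image inj_on_subset)
      have sub: "M ` A \<inter> B \<subseteq> {M l}" "M ` A \<inter> B \<noteq> {} \<Longrightarrow> l \<in> A \<and> M l \<in> B"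
        using AB(1,4) MG by blast+
      have sum: "card (M ` A \<union> B) + card (M ` A \<inter> B) = 9"
        using card_Un_Int[of "M ` A" B] fin cMA AB(3) by simp
      have sub8: "M ` A \<union> B \<subseteq> {..<8}" using AB(1,2) M8 by auto
      then have le8: "card (M ` A \<union> B) \<le> 8" using card_mono[OF finite_lessThan sub8] by simp
      then have "M ` A \<inter> B \<noteq> {}" using sum by auto
      then have lA: "l \<in> A" "M l \<in> B" using sub(2) by auto
      have "card (M ` A \<inter> B) \<le> 1" using card_mono[OF _ sub(1)] by simp
      \<comment> \<open>The sizes add up to 9 among 8 colours and only \<open>M l\<close> can be
        common, so \<open>B\<close> and the image of \<open>A\<close> cover all colours.\<close>
      then have "card (M ` A \<union> B) = card {..<8::nat}" using sum le8 by simp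
      then have all: "M ` A \<union> B = {..<8}" using card_subset_eq[OF finite_lessThan sub8] by simp
      have key: "j \<in> A - {l}" if ij: "i \<in> A" "(i, j) \<in> R" for i j
      proof -
        have r: "i < 8" "j < 8" "i \<noteq> j" "(i, M j) \<in> G - {e}" using ij(2) by (auto simp: R_def)
        have "(i, M j) \<noteq> (l, M l)" using r inj L8[OF l] by (auto simp: inj_on_def)
        then have "M j \<notin> B" using r ij(1) AB(4) by blast
        then have "M j \<in> M ` A" "M j \<noteq> M l" using all M8[OF r(2)] lA(2) by auto
        then show ?thesis using inj AB(1) r(2) by (auto dest: inj_onD)
      qed
      show ?thesis
        using key lA(1) by (intro exI[of _ "A - {l}"]) (auto simp: out_closed_def)
    qed
  qed
qed

text \<open>Two applications of \<open>reroute_one\<close>, the second only if the first changed a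
  single index of \<open>I\<close>. Half of the four indices are then rerouted, too few agreements
  for a second obstruction.\<close>

lemma reroute_two:
  fixes G :: "(nat \<times> nat) set"
  assumes G: "G \<subseteq> {..<8} \<times> {..<8}"
    and row: "\<And>i. i < 8 \<Longrightarrow> 3 \<le> card (G `` {i})"
    and col: "\<And>y. y < 8 \<Longrightarrow> 3 \<le> card (G\<inverse> `` {y})"
    and M: "avoids 8 (- G) M"
    and I: "I \<subseteq> {..<8}" "card I = 4"
  shows "\<exists>M'. avoids 8 (- G) M' \<and> card {i \<in> I. M' i = M i} \<le> 2"
proof -
  have finI: "finite I" using I(1) by (rule finite_subset) simp
  obtain L0 where L0: "L0 \<subseteq> I" "card L0 = 3" using obtain_subset_with_card_n[of 3 I] I(2) by auto
  \<comment> \<open>The pair \<open>(8, 8)\<close> lies outside the grid, so the first application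
    excludes no edge.\<close>
  have G8: "G - {(8, 8)} = G" using G by auto
  have "\<exists>M' l. avoids 8 (- (G - {(8, 8)})) M' \<and> l \<in> L0 \<and> M' l \<noteq> M l"
  proof (rule reroute_one[OF G row col])
    show "avoids 8 (- (G - {(8, 8)})) M" unfolding G8 by (rule M)
    show "L0 \<subseteq> {..<8}" "card L0 = 3" using L0 I(1) by blast+
  qed
  then obtain M1 l where M1: "avoids 8 (- G) M1" "l \<in> L0" "M1 l \<noteq> M l" unfolding G8 by blast
  have lI: "l \<in> I" using L0 M1 by blast
  have cL: "card (I - {l}) = 3" using lI I(2) by simp
  show ?thesis
  proof (cases "\<forall>i\<in>I - {l}. M1 i = M i")
    case False
    then obtain j where j: "j \<in> I" "j \<noteq> l" "M1 j \<noteq> M j" by blast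
    have "{i \<in> I. M1 i = M i} \<subseteq> I - {l, j}" using j M1(3) by auto
    then have "card {i \<in> I. M1 i = M i} \<le> card (I - {l, j})" using finI by (intro card_mono) auto
    also have "\<dots> = 2" using lI j I(2) finI by (simp add: card_Diff_subset)
    finally show ?thesis using M1(1) by blast
  next
    case True
    \<comment> \<open>The old edge at \<open>l\<close> is now excluded; \<open>M1\<close> remains
      valid, and no later matching can return to \<open>M l\<close>.\<close>
    have av1: "avoids 8 (- (G - {(l, M l)})) M1" using M1 by (auto simp: avoids_def)
    have "\<exists>M' j. avoids 8 (- (G - {(l, M l)})) M' \<and> j \<in> I - {l} \<and> M' j \<noteq> M1 j"
    proof (rule reroute_one[OF G row col av1 _ cL])
      show "I - {l} \<subseteq> {..<8}" using I(1) by blast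
    qed
    then obtain M2 j where M2: "avoids 8 (- (G - {(l, M l)})) M2" "j \<in> I - {l}" "M2 j \<noteq> M1 j" by blast
    have "l < 8" using lI I(1) by auto
    then have "M2 l \<noteq> M l" using M2(1) by (auto simp: avoids_def)
    moreover have "M2 j \<noteq> M j" using True M2 by auto
    ultimately have "{i \<in> I. M2 i = M i} \<subseteq> I - {l, j}" by auto
    then have "card {i \<in> I. M2 i = M i} \<le> card (I - {l, j})" using finI by (intro card_mono) auto
    also have "\<dots> = 2" using lI M2(2) I(2) finI by (simp add: card_Diff_subset)
    finally show ?thesis using M2(1) by (auto simp: avoids_def)
  qed
qed

section \<open>Packings of sparse conflict systems\<close>

lemma degree_le_UN_matchings:
  assumes "finite S" "\<And>s. s \<in> S \<Longrightarrow> partial_matching (P s) \<and> finite (P s)"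
  shows "degree_le (card S) (\<Union>s\<in>S. P s)"
  using assms
proof (induction S rule: finite_induct)
  case empty
  then show ?case by (simp add: degree_le_def)
next
  case (insert s S)
  then have "degree_le (Suc (card S)) ((\<Union>s\<in>S. P s) \<union> P s)"
    by (intro degree_le_Un_matching) auto
  then show ?case using insert by (simp add: Un_commute)
qed

lemma degree_le_mono: "degree_le k F \<Longrightarrow> k \<le> l \<Longrightarrow> degree_le l F"
  unfolding degree_le_def using order_trans by blast

lemma degree_complement:
  assumes "degree_le k F" "i < 8"
  shows "8 - k \<le> card (({..<8} \<times> {..<8} - F) `` {i})"
proof -
  have "({..<8} \<times> {..<8} - F) `` {i} = {..<8} - F `` {i}" using assms(2) by auto
  moreover have "finite (F `` {i})" using assms(1) by (simp add: degree_le_def finite_Image)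
  then have "8 - card (F `` {i}) \<le> card ({..<8::nat} - F `` {i})"
    using diff_card_le_card_Diff[of "F `` {i}" "{..<8}"] by simp
  moreover have "card (F `` {i}) \<le> k" using assms(1) by (simp add: degree_le_def)
  ultimately show ?thesis by simp
qed

text \<open>The unmatched rows and columns are equally many, so any bijection between them completes
  the matching.\<close>

lemma partial_matching_extends:
  fixes P :: "('b \<times> 'b) set"
  assumes "partial_matching P" "P \<subseteq> X \<times> X" "finite X"
  shows "\<exists>p. bij_betw p X X \<and> (\<forall>(x, y)\<in>P. y = p x)"
proof -
  define g where "g x = (THE y. (x, y) \<in> P)" for x
  have g: "g x = y" if "(x, y) \<in> P" for x y
    using assms(1) that unfolding g_def partial_matching_def by (auto dest: single_valuedD)
  have "inj_on g (Domain P)"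
    using assms(1) g unfolding partial_matching_def by (fastforce simp: inj_on_def dest: single_valuedD)
  moreover have "g ` Domain P = Range P" using g by force
  ultimately have b1: "bij_betw g (Domain P) (Range P)" by (simp add: bij_betw_def)
  have sub: "Domain P \<subseteq> X" "Range P \<subseteq> X" using assms(2) by auto
  then have "card (X - Domain P) = card (X - Range P)"
    using bij_betw_same_card[OF b1] assms(3) by (simp add: card_Diff_subset finite_subset)
  then obtain h where h: "bij_betw h (X - Domain P) (X - Range P)"
    using assms(3) by (meson finite_Diff finite_same_card_bij)
  let ?p = "\<lambda>x. if x \<in> Domain P then g x else h x"
  have "bij_betw ?p (Domain P) (Range P)"
    using b1 by (subst bij_betw_cong[of _ _ g]) auto
  moreover have "bij_betw ?p (X - Domain P) (X - Range P)"
    using h by (subst bij_betw_cong[of _ _ h]) auto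
  ultimately have "bij_betw ?p (Domain P \<union> (X - Domain P)) (Range P \<union> (X - Range P))"
    by (rule bij_betw_combine) auto
  then have "bij_betw ?p X X" using sub by (simp add: Un_absorb1)
  moreover have "\<forall>(x, y)\<in>P. y = ?p x" using g by auto
  ultimately show ?thesis by (intro exI[of _ ?p]) blast
qed

lemma cyclic_shift_bij: "bij_betw (\<lambda>x. (x + s) mod 8) {..<8} {..<8::nat}"
proof -
  have "inj_on (\<lambda>x. (x + s) mod 8) {..<8::nat}"
  proof (rule inj_onI)
    fix x y assume "x \<in> {..<8}" "y \<in> {..<8}" "(x + s) mod 8 = (y + s) mod 8"
    then obtain q r where "x + s + 8 * q = y + s + 8 * r" "x < 8" "y < 8"
      by (auto simp: nat_mod_eq_iff)
    then show "x = y" by presburger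
  qed
  moreover have "(\<lambda>x. (x + s) mod 8) ` {..<8} \<subseteq> {..<8::nat}" by auto
  ultimately show ?thesis by (simp add: bij_betw_def endo_inj_surj)
qed

section \<open>Packings in a conflict system and their extension\<close>

text \<open>An 8-fold cover with every list numbered from 0 to 7: \<open>N\<close> gives
  neighbourhoods and \<open>R u v\<close> the pairs of conflicting colours.\<close>

locale conflict_system =
  fixes N :: "'a \<Rightarrow> 'a set" and R :: "'a \<Rightarrow> 'a \<Rightarrow> (nat \<times> nat) set"
  assumes R_sub: "R u v \<subseteq> {..<8} \<times> {..<8}"
    and R_matching: "partial_matching (R u v)"
    and R_converse: "R v u = (R u v)\<inverse>"
    and R_nonadjacent: "u \<notin> N v \<Longrightarrow> R u v = {}"
    and N_sym: "u \<in> N v \<Longrightarrow> v \<in> N u"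
    and N_irrefl: "v \<notin> N v"
begin

text \<open>\<open>f v i\<close> is the colour of \<open>v\<close> in the \<open>i\<close>-th
  transversal; bijectivity at \<open>v\<close> makes the transversals disjoint there.\<close>

definition packs :: "'a set \<Rightarrow> ('a \<Rightarrow> nat \<Rightarrow> nat) \<Rightarrow> bool" where
  "packs W f \<longleftrightarrow> (\<forall>v\<in>W. bij_betw (f v) {..<8} {..<8}) \<and>
     (\<forall>u\<in>W. \<forall>v\<in>W. \<forall>i<8. (f u i, f v i) \<notin> R u v)"

text \<open>The pairs of index and colour at \<open>v\<close> that the permutation \<open>g\<close>
  at \<open>u\<close> rules out. This is \<open>R u v\<close> composed with \<open>g\<close>, hence
  again a partial matching.\<close>

definition forb :: "(nat \<Rightarrow> nat) \<Rightarrow> 'a \<Rightarrow> 'a \<Rightarrow> (nat \<times> nat) set" where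
  "forb g u v = {(i, y). i < 8 \<and> (g i, y) \<in> R u v}"

definition forbidden :: "('a \<Rightarrow> nat \<Rightarrow> nat) \<Rightarrow> 'a set \<Rightarrow> 'a \<Rightarrow> (nat \<times> nat) set" where
  "forbidden f U v = (\<Union>u\<in>N v \<inter> U. forb (f u) u v)"

lemma forb_sub: "forb g u v \<subseteq> {..<8} \<times> {..<8}"
  using R_sub by (auto simp: forb_def)

lemma forb_finite: "finite (forb g u v)"
  using forb_sub by (rule finite_subset) simp

lemma forb_matching:
  assumes "bij_betw g {..<8} {..<8}"
  shows "partial_matching (forb g u v)"
proof -
  have inj: "inj_on g {..<8}" using assms by (simp add: bij_betw_def)
  have "single_valued (forb g u v)"
    using R_matching[of u v] by (auto simp: partial_matching_def forb_def single_valued_def)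
  moreover have "single_valued ((forb g u v)\<inverse>)"
  proof (rule single_valuedI)
    fix y i j assume "(y, i) \<in> (forb g u v)\<inverse>" "(y, j) \<in> (forb g u v)\<inverse>"
    then have ij: "i < 8" "j < 8" "(g i, y) \<in> R u v" "(g j, y) \<in> R u v" by (auto simp: forb_def)
    then have "g i = g j" using R_matching[of u v] by (auto simp: partial_matching_def single_valued_def)
    then show "i = j" using inj ij by (auto dest: inj_onD)
  qed
  ultimately show ?thesis by (simp add: partial_matching_def)
qed

lemma forbidden_degree:
  assumes "finite U" "packs W f" "U \<subseteq> W" "card (N v \<inter> U) \<le> k"
  shows "degree_le k (forbidden f U v)"
proof -
  have "degree_le (card (N v \<inter> U)) (forbidden f U v)"
    unfolding forbidden_def using assms
    by (intro degree_le_UN_matchings) (auto simp: packs_def intro!: forb_matching forb_finite)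
  then show ?thesis using assms(4) by (rule degree_le_mono)
qed

lemma packs_mono: "packs W f \<Longrightarrow> U \<subseteq> W \<Longrightarrow> packs U f"
  unfolding packs_def by blast

text \<open>No two vertices of \<open>D\<close> are adjacent, so each can be coloured separately
  against \<open>W\<close>.\<close>

lemma packs_extend:
  assumes "packs W f" "D \<inter> W = {}" "\<And>u v. u \<in> D \<Longrightarrow> v \<in> D \<Longrightarrow> u \<notin> N v"
    and "\<And>v. v \<in> D \<Longrightarrow> avoids 8 (forbidden f W v) (g v)"
  shows "packs (W \<union> D) (\<lambda>x. if x \<in> D then g x else f x)"
proof -
  have new: "(f u i, g v i) \<notin> R u v" if "u \<in> W" "v \<in> D" "i < 8" for u v i
  proof
    assume a: "(f u i, g v i) \<in> R u v"
    then have "u \<in> N v" using R_nonadjacent by auto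
    then have "(i, g v i) \<in> forbidden f W v" using a that by (auto simp: forbidden_def forb_def)
    then show False using assms(4)[OF that(2)] that(3) by (auto simp: avoids_def)
  qed
  have new': "(g v i, f u i) \<notin> R v u" if "u \<in> W" "v \<in> D" "i < 8" for u v i
    using new[OF that] R_converse[of v u] by auto
  have indep: "R u v = {}" if "u \<in> D" "v \<in> D" for u v
    using assms(3)[OF that] R_nonadjacent by auto
  show ?thesis
    unfolding packs_def
  proof (intro conjI ballI allI impI)
    fix v assume "v \<in> W \<union> D"
    then show "bij_betw (if v \<in> D then g v else f v) {..<8} {..<8}"
      using assms(1,4) by (auto simp: packs_def avoids_def)
  next
    fix u v i assume "u \<in> W \<union> D" "v \<in> W \<union> D" "i < (8::nat)"
    then show "((if u \<in> D then g u else f u) i, (if v \<in> D then g v else f v) i) \<notin> R u v"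
      using new[of u v i] new'[of v u i] indep[of u v] assms(1) by (auto simp: packs_def)
  qed
qed

lemma packs_extend_vertex:
  assumes "packs W f" "v \<notin> W" "avoids 8 (forbidden f W v) g"
  shows "packs (insert v W) (f(v := g))"
proof -
  have "packs (W \<union> {v}) (\<lambda>x. if x \<in> {v} then g else f x)"
    using assms N_irrefl by (intro packs_extend) auto
  moreover have "(\<lambda>x. if x \<in> {v} then g else f x) = f(v := g)" by auto
  ultimately show ?thesis by simp
qed

lemma packs_avoids:
  assumes "packs W f" "v \<in> W" "U \<subseteq> W"
  shows "avoids 8 (forbidden f U v) (f v)"
  using assms by (auto simp: packs_def avoids_def forbidden_def forb_def)

section \<open>Reducible configurations\<close>

lemma reducible_degree_4:
  assumes "finite W" "v \<in> W" "card (N v \<inter> W) \<le> 4" "packs (W - {v}) f"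
  shows "\<exists>f. packs W f"
proof -
  have "N v \<inter> (W - {v}) = N v \<inter> W" using N_irrefl by auto
  then have "degree_le 4 (forbidden f (W - {v}) v)"
    using assms by (intro forbidden_degree[OF _ assms(4)]) auto
  then obtain g where "avoids 8 (forbidden f (W - {v}) v) g" using avoids_exists_degree_4 by blast
  then have "packs (insert v (W - {v})) (f(v := g))"
    using assms(4) by (intro packs_extend_vertex) auto
  then show ?thesis using assms(2) by (metis insert_Diff)
qed

text \<open>An entry common to both matchings pairs \<open>g i\<close> and \<open>h i\<close> with
  the same colour of \<open>v\<close>, so \<open>g i = h i\<close>. The set \<open>I\<close> only
  needs to contain the indices that \<open>g\<close> contributes to its grid.\<close>

lemma two_obstructions_agree:
  assumes "degree_le 4 F" "bij_betw g {..<8} {..<8}" "bij_betw h {..<8} {..<8}"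
    "obstruction (F \<union> forb g u v) A B" "obstruction (F \<union> forb h u v) A' B'"
    "fst ` (forb g u v \<inter> A \<times> B) \<subseteq> I" "finite I"
  shows "3 \<le> card {i \<in> I. g i = h i}"
proof -
  let ?X = "forb g u v \<inter> forb h u v \<inter> A \<times> B"
  have "3 \<le> card ?X"
    using two_obstructions[OF assms(1) forb_matching forb_matching forb_finite forb_finite] assms by blast
  also have "\<dots> = card (fst ` ?X)"
  proof -
    have "inj_on fst (forb g u v)"
      using forb_matching[OF assms(2), of u v]
      by (auto simp: inj_on_def partial_matching_def single_valued_def)
    then show ?thesis by (metis card_image inf.assoc inf_le1 inj_on_subset)
  qed
  also have "fst ` ?X \<subseteq> {i \<in> I. g i = h i}"
  proof
    fix i assume "i \<in> fst ` ?X"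
    then obtain y where y: "(i, y) \<in> forb g u v" "(i, y) \<in> forb h u v" "(i, y) \<in> A \<times> B" by auto
    then have "i \<in> fst ` (forb g u v \<inter> A \<times> B)" by force
    then have "i \<in> I" using assms(6) by blast
    moreover have "g i = h i"
      using y(1,2) R_matching[of u v] by (auto simp: forb_def partial_matching_def single_valued_def)
    ultimately show "i \<in> {i \<in> I. g i = h i}" by simp
  qed
  then have "card (fst ` ?X) \<le> card {i \<in> I. g i = h i}" using assms(7) by (intro card_mono) auto
  finally show ?thesis .
qed

text \<open>If the packing does not extend to \<open>v\<close>, the permutation of \<open>u\<close>
  is rerouted until it agrees with the old one on at most two critical indices. A second obstruction
  would need three.\<close>

lemma reducible_5_6:
  assumes fin: "finite W" and v: "v \<in> W" "card (N v \<inter> W) \<le> 5"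
    and u: "u \<in> W" "u \<in> N v" "card (N u \<inter> W) \<le> 6" and f: "packs (W - {v}) f"
  shows "\<exists>f. packs W f"
proof -
  let ?U = "W - {v, u}"
  define F where "F = forbidden f ?U v"
  have uv: "u \<noteq> v" using u(2) N_irrefl by auto
  have split: "forbidden f' (W - {v}) v = F \<union> forb (f' u) u v" if "\<And>w. w \<in> ?U \<Longrightarrow> f' w = f w" for f'
  proof -
    have "N v \<inter> (W - {v}) = insert u (N v \<inter> ?U)" using u uv by auto
    then show ?thesis using that by (auto simp: F_def forbidden_def)
  qed
  have "N v \<inter> ?U = N v \<inter> W - {u}" using N_irrefl by auto
  then have "card (N v \<inter> ?U) \<le> 4" using v u fin by (simp add: card_Diff_subset)
  then have F4: "degree_le 4 F" unfolding F_def using fin by (intro forbidden_degree[OF _ f]) auto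
  have ext: ?thesis if "packs (W - {v}) f'" "\<And>w. w \<in> ?U \<Longrightarrow> f' w = f w"
    "avoids 8 (F \<union> forb (f' u) u v) g" for f' g
  proof -
    have "packs (insert v (W - {v})) (f'(v := g))"
      using that split[of f'] by (intro packs_extend_vertex) auto
    then show ?thesis using v(1) by (metis insert_Diff)
  qed
  let ?H = "forbidden f ?U u"
  have "N u \<inter> ?U = N u \<inter> W - {v}" using N_irrefl by auto
  then have "card (N u \<inter> ?U) \<le> 5" using v u fin N_sym[OF u(2)] by (simp add: card_Diff_subset)
  then have H5: "degree_le 5 ?H" using fin by (intro forbidden_degree[OF _ f]) auto
  \<comment> \<open>Without \<open>v\<close> there are at most five neighbours of \<open>u\<close>
    left, so every row and column of \<open>G\<close> keeps 8 - 5 = 3 allowed partners, as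
    \<open>reroute_two\<close> requires.\<close>
  define G where "G = {..<8} \<times> {..<8} - ?H"
  have G8: "G \<subseteq> {..<8} \<times> {..<8}" by (auto simp: G_def)
  have row: "3 \<le> card (G `` {i})" if "i < 8" for i
    using degree_complement[OF H5 that] by (simp add: G_def)
  have "G\<inverse> = {..<8} \<times> {..<8} - ?H\<inverse>" by (auto simp: G_def)
  then have col: "3 \<le> card (G\<inverse> `` {i})" if "i < 8" for i
    using degree_complement[of 5 "?H\<inverse>", OF _ that] H5 by simp
  have avG: "avoids 8 (- G) g \<longleftrightarrow> avoids 8 ?H g" for g
    by (auto simp: avoids_def G_def bij_betw_def)
  have fu: "avoids 8 ?H (f u)" using u uv by (intro packs_avoids[OF f]) auto
  show ?thesis
  proof (cases "\<exists>g. avoids 8 (F \<union> forb (f u) u v) g")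
    case True
    then show ?thesis using ext[of f] f by blast
  next
    case False
    then obtain A B where AB: "obstruction (F \<union> forb (f u) u v) A B" using obstruction_exists by blast
    have bu: "bij_betw (f u) {..<8} {..<8}" using fu by (simp add: avoids_def)
    let ?L = "forb (f u) u v \<inter> A \<times> B"
    have finAB: "finite A" "finite B" using AB by (auto simp: obstruction_def intro: finite_subset)
    have inj: "inj_on fst ?L" "inj_on snd ?L"
      using forb_matching[OF bu, of u v]
      by (auto simp: inj_on_def partial_matching_def single_valued_def)
    have "card (fst ` ?L) \<le> card A" using finAB by (intro card_mono) auto
    moreover have "card (snd ` ?L) \<le> card B" using finAB by (intro card_mono) auto
    moreover have "card A + card B = 9" using AB by (simp add: obstruction_def)
    \<comment> \<open>\<open>?L\<close> is a matching inside the grid, so it is no larger than the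
      smaller of two sides adding up to 9. \<open>I\<close> pads its indices to exactly
      four.\<close>
    ultimately have "card (fst ` ?L) \<le> 4" using card_image[OF inj(1)] card_image[OF inj(2)] by linarith
    moreover have "fst ` ?L \<subseteq> {..<8}" using AB by (auto simp: obstruction_def)
    ultimately obtain I where I: "fst ` ?L \<subseteq> I" "I \<subseteq> {..<8}" "card I = 4"
      using exists_subset_between[of "fst ` ?L" 4 "{..<8}"] by auto
    obtain g where g: "avoids 8 ?H g" "card {i \<in> I. g i = f u i} \<le> 2"
      using reroute_two[OF G8 row col _ I(2,3), of "f u"] fu unfolding avG by blast
    have "packs (insert u ?U) (f(u := g))"
      using packs_mono[OF f, of ?U] g(1) by (intro packs_extend_vertex) auto
    moreover have "insert u ?U = W - {v}" using u uv by auto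
    ultimately have f': "packs (W - {v}) (f(u := g))" by simp
    have "\<exists>h. avoids 8 (F \<union> forb g u v) h"
    proof (rule ccontr)
      assume "\<not> ?thesis"
      then obtain A' B' where AB': "obstruction (F \<union> forb g u v) A' B'" using obstruction_exists by blast
      have "bij_betw g {..<8} {..<8}" using g(1) by (simp add: avoids_def)
      then have "3 \<le> card {i \<in> I. f u i = g i}"
        using two_obstructions_agree[OF F4 bu _ AB AB' I(1)] I(2) by (meson finite_lessThan finite_subset)
      moreover have "{i \<in> I. f u i = g i} = {i \<in> I. g i = f u i}" by auto
      ultimately show False using g(2) by simp
    qed
    then show ?thesis using ext[OF f'] by auto
  qed
qed

text \<open>Outside \<open>D\<close>, the vertex \<open>u\<close> has at most one neighbour, which
  leaves seven disjoint permutations for \<open>u\<close>. Six vertices in \<open>D\<close> veto at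
  most one each, so one permutation suits all of them.\<close>

lemma reducible_7_star:
  assumes fin: "finite W" and u: "u \<in> W" "card (N u \<inter> W) \<le> 7"
    and D: "D \<subseteq> N u \<inter> W" "card D = 6" "\<And>v. v \<in> D \<Longrightarrow> card (N v \<inter> W) \<le> 5"
    "\<And>v w. v \<in> D \<Longrightarrow> w \<in> D \<Longrightarrow> v \<notin> N w"
    and f: "packs (W - D - {u}) f"
  shows "\<exists>f. packs W f"
proof -
  let ?U = "W - D - {u}"
  have finD: "finite D" using D(2) by (simp add: card_ge_0_finite)
  have uD: "u \<notin> D" using D(1) N_irrefl by auto
  have "N u \<inter> ?U = N u \<inter> W - D" using N_irrefl by auto
  then have c1: "card (N u \<inter> ?U) \<le> 1" using D fin finD u by (simp add: card_Diff_subset)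
  have "partial_matching (forbidden f ?U u)"
  proof (cases "N u \<inter> ?U = {}")
    case True
    then show ?thesis by (simp add: forbidden_def partial_matching_def)
  next
    case False
    then obtain w where "N u \<inter> ?U = {w}"
      using c1 fin by (metis card_1_singletonE card_0_eq finite_Diff finite_Int le_Suc_eq le_zero_eq One_nat_def)
    then have "forbidden f ?U u = forb (f w) w u" "w \<in> ?U" by (auto simp: forbidden_def)
    then show ?thesis using f forb_matching by (auto simp: packs_def)
  qed
  moreover have "forbidden f ?U u \<subseteq> {..<8} \<times> {..<8}" using forb_sub by (auto simp: forbidden_def)
  ultimately obtain p where p: "bij_betw p {..<8} {..<8}" "\<forall>(i, y)\<in>forbidden f ?U u. y = p i"
    using partial_matching_extends[of _ "{..<8}"] by (metis finite_lessThan)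
  \<comment> \<open>\<open>p\<close> contains every forbidden pair at \<open>u\<close>. The shift by
    0 is \<open>p\<close> itself; the shifts by 1 to 7 differ from \<open>p\<close> at every
    index.\<close>
  define M where "M s i = (p i + s) mod 8" for s i
  have p8: "p i < 8" if "i < 8" for i using p(1) that by (auto simp: bij_betw_def)
  have bM: "bij_betw (M s) {..<8} {..<8}" for s
    using bij_betw_trans[OF p(1) cyclic_shift_bij[of s]] by (simp add: M_def[abs_def] comp_def)
  have M_avoids: "avoids 8 (forbidden f ?U u) (M s)" if s: "s \<in> {1..7}" for s
  proof -
    have "(i, M s i) \<notin> forbidden f ?U u" if "i < 8" for i
    proof
      assume "(i, M s i) \<in> forbidden f ?U u"
      then have "(s + p i) mod 8 = (0 + p i) mod 8" using p(2) p8[OF that] by (auto simp: M_def add.commute)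
      moreover have "inj_on (\<lambda>x. (x + p i) mod 8) {..<8}" using cyclic_shift_bij by (simp add: bij_betw_def)
      moreover have "s \<in> {..<8}" "(0::nat) \<in> {..<8}" using s by auto
      ultimately have "s = 0" by (metis (mono_tags) inj_onD)
      then show False using s by simp
    qed
    then show ?thesis using bM by (simp add: avoids_def)
  qed
  have M_differ: "M s i \<noteq> M t i" if "s \<in> {1..7}" "t \<in> {1..7}" "s \<noteq> t" for s t i
  proof
    assume "M s i = M t i"
    then have "(s + p i) mod 8 = (t + p i) mod 8" by (simp add: M_def add.commute)
    moreover have "inj_on (\<lambda>x. (x + p i) mod 8) {..<8}" using cyclic_shift_bij by (simp add: bij_betw_def)
    ultimately show False using that by (auto dest!: inj_onD)
  qed
  have deg: "degree_le 4 (forbidden f ?U v)" if v: "v \<in> D" for v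
  proof (rule forbidden_degree[OF _ f])
    have "u \<in> N v" using v D(1) N_sym by blast
    then have "card (N v \<inter> W - {u}) \<le> 4" using D(3)[OF v] fin u by (simp add: card_Diff_subset)
    moreover have "card (N v \<inter> ?U) \<le> card (N v \<inter> W - {u})" using fin by (intro card_mono) auto
    ultimately show "card (N v \<inter> ?U) \<le> 4" by simp
  qed (use fin in auto)
  define bad where "bad v s \<longleftrightarrow> (\<nexists>g. avoids 8 (forbidden f ?U v \<union> forb (M s) u v) g)" for v s
  have bad_unique: "s = t" if st: "v \<in> D" "bad v s" "bad v t" "s \<in> {1..7}" "t \<in> {1..7}" for v s t
  proof (rule ccontr)
    assume "s \<noteq> t"
    \<comment> \<open>Different shifts never agree, while two obstructions at \<open>v\<close> would
      force three agreements.\<close>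
    then have empty: "{i \<in> {..<8}. M s i = M t i} = {}" using M_differ st by auto
    obtain A B where AB: "obstruction (forbidden f ?U v \<union> forb (M s) u v) A B"
      using obstruction_exists st(2) unfolding bad_def by blast
    obtain A' B' where AB': "obstruction (forbidden f ?U v \<union> forb (M t) u v) A' B'"
      using obstruction_exists st(3) unfolding bad_def by blast
    have "fst ` (forb (M s) u v \<inter> A \<times> B) \<subseteq> {..<8}" using AB by (auto simp: obstruction_def)
    from two_obstructions_agree[OF deg[OF st(1)] bM bM AB AB' this finite_lessThan]
    show False unfolding empty by simp
  qed
  have "\<exists>s\<in>{1..7}. \<forall>v\<in>D. \<not> bad v s"
  proof (rule ccontr)
    assume "\<not> ?thesis"
    then obtain h where h: "\<And>s. s \<in> {1..7} \<Longrightarrow> h s \<in> D \<and> bad (h s) s" by metis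
    then have "inj_on h {1..7}" using bad_unique by (metis inj_onI)
    then have "card {1..7::nat} \<le> card D" using h finD by (intro card_inj_on_le) auto
    then show False using D(2) by simp
  qed
  then obtain s where s: "s \<in> {1..7}" "\<And>v. v \<in> D \<Longrightarrow> \<not> bad v s" by blast
  let ?f = "f(u := M s)"
  have f': "packs (insert u ?U) ?f" using M_avoids[OF s(1)] f by (intro packs_extend_vertex) auto
  have "forbidden ?f (insert u ?U) v \<subseteq> forbidden f ?U v \<union> forb (M s) u v" for v
    by (auto simp: forbidden_def split: if_splits)
  then have "\<exists>g. avoids 8 (forbidden ?f (insert u ?U) v) g" if "v \<in> D" for v
    using s(2)[OF that] unfolding bad_def avoids_def by blast
  then obtain g where "\<And>v. v \<in> D \<Longrightarrow> avoids 8 (forbidden ?f (insert u ?U) v) (g v)" by metis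
  then have "packs (insert u ?U \<union> D) (\<lambda>x. if x \<in> D then g x else ?f x)"
    using uD D(4) by (intro packs_extend[OF f']) auto
  moreover have "insert u ?U \<union> D = W" using D(1) u(1) by auto
  ultimately show ?thesis by auto
qed

section \<open>Discharging and induction on the vertex set\<close>

text \<open>Without the configuration no final charge is negative: a 5-vertex starts at -1 and gets
  1/5 from each neighbour, a 7-vertex gives away at most 5/5, and degree \<open>d\<close> at least 8
  satisfies \<open>d - 6 \<ge> d / 5\<close>. The total charge is negative by sparsity.\<close>

lemma sparse_configuration:
  assumes fin: "finite W" and sparse: "(\<Sum>v\<in>W. card (N v \<inter> W)) < 6 * card W"
    and min5: "\<And>v. v \<in> W \<Longrightarrow> 5 \<le> card (N v \<inter> W)"
    and nbr7: "\<And>u v. v \<in> W \<Longrightarrow> u \<in> N v \<inter> W \<Longrightarrow> card (N v \<inter> W) = 5 \<Longrightarrow> 7 \<le> card (N u \<inter> W)"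
  shows "\<exists>u\<in>W. card (N u \<inter> W) = 7 \<and> 6 \<le> card {v \<in> N u \<inter> W. card (N v \<inter> W) = 5}"
proof (rule ccontr)
  assume no: "\<not> ?thesis"
  define d where "d v = card (N v \<inter> W)" for v
  define t where "t u = card {v \<in> N u \<inter> W. d v = 5}" for u
  \<comment> \<open>Discharging, scaled by 5: each vertex of degree d > 6 with charge d - 6 sends 1/5 to every
    neighbour of degree 5.\<close>
  have local: "t u + 30 \<le> 5 * d u + (if d u = 5 then 5 else 0)" if u: "u \<in> W" for u
  proof -
    have td: "t u \<le> d u" unfolding t_def d_def using fin by (intro card_mono) auto
    have zero: "t u = 0" if "d u < 7"
    proof -
      have "{v \<in> N u \<inter> W. d v = 5} = {}" using nbr7 that u N_sym unfolding d_def by force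
      then show ?thesis unfolding t_def by (simp only: card.empty)
    qed
    have "t u \<le> 5" if "d u = 7" using no u that unfolding t_def d_def by force
    then show ?thesis using td zero min5[OF u] unfolding d_def[symmetric] by fastforce
  qed
  \<comment> \<open>Counting the edges at 5-vertices from their other end: the charge sent equals
    the charge received.\<close>
  have "(\<Sum>u\<in>W. t u) = (\<Sum>u\<in>W. card {v \<in> {v\<in>W. d v = 5}. v \<in> N u})"
    unfolding t_def by (intro sum.cong refl arg_cong[where f = card]) auto
  also have "\<dots> = 5 * card {v\<in>W. d v = 5}"
  proof (rule sum_multicount)
    show "\<forall>v\<in>{v \<in> W. d v = 5}. card {u \<in> W. v \<in> N u} = 5"
    proof
      fix v assume "v \<in> {v \<in> W. d v = 5}"
      moreover have "{u \<in> W. v \<in> N u} = N v \<inter> W" using N_sym by auto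
      ultimately show "card {u \<in> W. v \<in> N u} = 5" by (simp add: d_def)
    qed
  qed (use fin in auto)
  finally have T: "(\<Sum>u\<in>W. t u) = 5 * card {v\<in>W. d v = 5}" .
  have "(\<Sum>u\<in>W. if d u = 5 then 5 else 0) = 5 * card {v\<in>W. d v = 5}"
    using fin by (simp add: sum.If_cases Int_def)
  moreover have "(\<Sum>u\<in>W. t u + 30) \<le> (\<Sum>u\<in>W. 5 * d u + (if d u = 5 then 5 else 0))"
    by (rule sum_mono) (rule local)
  ultimately have "30 * card W \<le> 5 * (\<Sum>u\<in>W. d u)"
    using T by (simp add: sum.distrib sum_distrib_left)
  then show False using sparse by (simp add: d_def)
qed

theorem sparse_packs:
  assumes "finite V" and "\<And>W. W \<subseteq> V \<Longrightarrow> W \<noteq> {} \<Longrightarrow> (\<Sum>v\<in>W. card (N v \<inter> W)) < 6 * card W"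
  shows "\<exists>f. packs V f"
  using assms
proof (induction V rule: finite_psubset_induct)
  case (psubset W)
  have IH: "\<exists>f. packs U f" if "U \<subset> W" for U
    using psubset.IH[OF that] psubset.prems that by blast
  show ?case
  proof (cases "W = {}")
    case True
    then show ?thesis by (simp add: packs_def)
  next
    case False
    show ?thesis
    proof (rule ccontr)
      assume no: "\<not> ?thesis"
      have min5: "5 \<le> card (N v \<inter> W)" if "v \<in> W" for v
        using reducible_degree_4[OF psubset.hyps that] IH[of "W - {v}"] that no by force
      have nbr7: "7 \<le> card (N u \<inter> W)" if "v \<in> W" "u \<in> N v \<inter> W" "card (N v \<inter> W) = 5" for u v
        using reducible_5_6[OF psubset.hyps, of v u] IH[of "W - {v}"] that no by force
      have "\<exists>u\<in>W. card (N u \<inter> W) = 7 \<and> 6 \<le> card {v \<in> N u \<inter> W. card (N v \<inter> W) = 5}"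
      proof (rule sparse_configuration)
        show "finite W" by (rule psubset.hyps)
        show "(\<Sum>v\<in>W. card (N v \<inter> W)) < 6 * card W" by (rule psubset.prems[OF order_refl False])
      qed (fact min5 nbr7)+
      then obtain u where u: "u \<in> W" "card (N u \<inter> W) = 7"
        "6 \<le> card {v \<in> N u \<inter> W. card (N v \<inter> W) = 5}" by blast
      obtain D where D: "D \<subseteq> {v \<in> N u \<inter> W. card (N v \<inter> W) = 5}" "card D = 6"
        by (rule obtain_subset_with_card_n[OF u(3)])
      have "W - D - {u} \<subset> W" using u(1) by blast
      then obtain f where f: "packs (W - D - {u}) f" using IH by blast
      \<comment> \<open>Adjacent 5-vertices would contradict \<open>nbr7\<close>.\<close>
      have indep: "v \<notin> N w" if "v \<in> D" "w \<in> D" for v w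
      proof
        assume "v \<in> N w"
        then have "7 \<le> card (N v \<inter> W)" using that D(1) by (intro nbr7[of w v]) auto
        moreover have "card (N v \<inter> W) = 5" using that D(1) by auto
        ultimately show False by simp
      qed
      have "\<exists>f. packs W f"
      proof (rule reducible_7_star[OF psubset.hyps u(1) _ _ D(2) _ indep f])
        show "card (N u \<inter> W) \<le> 7" using u(2) by simp
        show "D \<subseteq> N u \<inter> W" "\<And>v. v \<in> D \<Longrightarrow> card (N v \<inter> W) \<le> 5" using D(1) by auto
      qed
      then show False using no by blast
    qed
  qed
qed

end

section \<open>Many edges force a K5 minor\<close>

definition nbhd :: "'a set set \<Rightarrow> 'a \<Rightarrow> 'a set" where
  "nbhd E v = {u. {u, v} \<in> E}"

definition edges_in :: "'a set set \<Rightarrow> 'a set \<Rightarrow> 'a set set" where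
  "edges_in E W = {e \<in> E. e \<subseteq> W}"

lemma simple_graph_edgeE:
  assumes "simple_graph V E" "e \<in> E"
  obtains u v where "e = {u, v}" "u \<noteq> v" "u \<in> V" "v \<in> V"
  using assms unfolding simple_graph_def by meson

lemma simple_graph_edge:
  assumes "simple_graph V E" "{u, v} \<in> E"
  shows "u \<in> V" "v \<in> V" "u \<noteq> v"
proof -
  obtain x y where "{u, v} = {x, y}" "x \<noteq> y" "x \<in> V" "y \<in> V"
    using assms by (rule simple_graph_edgeE)
  then show "u \<in> V" "v \<in> V" "u \<noteq> v" by (auto simp: doubleton_eq_iff)
qed

lemma simple_graph_edges_in:
  assumes "simple_graph V E" "W \<subseteq> V"
  shows "simple_graph W (edges_in E W)"
  unfolding simple_graph_def
proof (intro conjI ballI)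
  show "finite W" using assms finite_subset by (auto simp: simple_graph_def)
  fix e assume "e \<in> edges_in E W"
  then have e: "e \<in> E" "e \<subseteq> W" by (auto simp: edges_in_def)
  obtain u v where "e = {u, v}" "u \<noteq> v" using simple_graph_edgeE[OF assms(1) e(1)] .
  with e(2) show "\<exists>u v. e = {u, v} \<and> u \<noteq> v \<and> u \<in> W \<and> v \<in> W" by auto
qed

lemma simple_graph_finite_edges:
  assumes "simple_graph V E" shows "finite E"
proof (rule finite_subset)
  show "E \<subseteq> Pow V" using assms by (auto simp: simple_graph_def)
  show "finite (Pow V)" using assms by (simp add: simple_graph_def)
qed

lemma nbhd_subset:
  assumes "simple_graph V E" shows "nbhd E v \<subseteq> V - {v}"
proof
  fix u assume "u \<in> nbhd E v"
  then have "{u, v} \<in> E" by (simp add: nbhd_def)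
  from simple_graph_edge[OF assms this] show "u \<in> V - {v}" by simp
qed

lemma nbhd_finite:
  assumes "simple_graph V E" shows "finite (nbhd E v)"
  using nbhd_subset[OF assms, of v] assms finite_subset by (fastforce simp: simple_graph_def)

lemma nbhd_sym: "u \<in> nbhd E v \<longleftrightarrow> v \<in> nbhd E u"
  by (simp add: nbhd_def insert_commute)

lemma card_incident_edges:
  assumes "simple_graph V E"
  shows "card {e \<in> E. v \<in> e} = card (nbhd E v)"
proof -
  have "inj_on (\<lambda>u. {u, v}) (nbhd E v)" by (auto simp: inj_on_def doubleton_eq_iff)
  moreover have "(\<lambda>u. {u, v}) ` nbhd E v = {e \<in> E. v \<in> e}"
  proof (intro equalityI subsetI)
    fix e assume e: "e \<in> {e \<in> E. v \<in> e}"
    then obtain x y where "e = {x, y}" using simple_graph_edgeE[OF assms] by blast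
    with e obtain u where "e = {u, v}" by auto
    with e show "e \<in> (\<lambda>u. {u, v}) ` nbhd E v" by (auto simp: nbhd_def)
  qed (auto simp: nbhd_def)
  ultimately show ?thesis by (metis card_image)
qed

lemma handshake:
  assumes "simple_graph V E"
  shows "(\<Sum>v\<in>V. card (nbhd E v)) = 2 * card E"
proof -
  have "(\<Sum>v\<in>V. card {e \<in> E. v \<in> e}) = 2 * card E"
  proof (rule sum_multicount)
    show "\<forall>e\<in>E. card {v \<in> V. v \<in> e} = 2"
    proof
      fix e assume "e \<in> E"
      with assms obtain u v where "e = {u, v}" "u \<noteq> v" "u \<in> V" "v \<in> V"
        by (rule simple_graph_edgeE)
      moreover from this have "{w \<in> V. w \<in> e} = {u, v}" by auto
      ultimately show "card {v \<in> V. v \<in> e} = 2" by simp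
    qed
  qed (use assms simple_graph_finite_edges in \<open>auto simp: simple_graph_def\<close>)
  then show ?thesis using card_incident_edges[OF assms] by simp
qed

section \<open>K5 minors and edge contraction\<close>

lemma connected_in_mono:
  assumes "connected_in E S" "E \<subseteq> E'" shows "connected_in E' S"
proof -
  have "(\<lambda>a b. a \<in> S \<and> b \<in> S \<and> {a, b} \<in> E)\<^sup>*\<^sup>* \<le> (\<lambda>a b. a \<in> S \<and> b \<in> S \<and> {a, b} \<in> E')\<^sup>*\<^sup>*"
    using assms(2) by (intro rtranclp_mono) auto
  then show ?thesis using assms(1) by (auto simp: connected_in_def)
qed

lemma connected_in_singleton: "connected_in E {a}"
  by (simp add: connected_in_def)

lemma connected_in_edge:
  assumes "{a, b} \<in> E" shows "connected_in E {a, b}"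
  using assms by (auto simp: connected_in_def insert_commute intro: r_into_rtranclp)

lemma has_K5_minor_mono:
  fixes V W :: "'a set"
  assumes "has_K5_minor W F" "W \<subseteq> V" "F \<subseteq> E" shows "has_K5_minor V E"
proof -
  obtain B :: "nat \<Rightarrow> 'a set" where B: "\<forall>i<5. B i \<noteq> {} \<and> B i \<subseteq> W \<and> connected_in F (B i)"
    "\<forall>i<5. \<forall>j<5. i \<noteq> j \<longrightarrow> B i \<inter> B j = {} \<and> (\<exists>u\<in>B i. \<exists>v\<in>B j. {u, v} \<in> F)"
    using assms(1) unfolding has_K5_minor_def by blast
  have "\<forall>i<5. B i \<noteq> {} \<and> B i \<subseteq> V \<and> connected_in E (B i)"
    using B(1) assms(2,3) connected_in_mono by blast
  moreover have "\<forall>i<5. \<forall>j<5. i \<noteq> j \<longrightarrow> B i \<inter> B j = {} \<and> (\<exists>u\<in>B i. \<exists>v\<in>B j. {u, v} \<in> E)"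
    using B(2) assms(3) by (meson subsetD)
  ultimately show ?thesis unfolding has_K5_minor_def by blast
qed

text \<open>By symmetry of disjointness and adjacency, only the ten ordered positions of a list of
  branch sets need checking.\<close>

lemma has_K5_minorI:
  assumes "length Bs = 5" "\<And>X. X \<in> set Bs \<Longrightarrow> X \<noteq> {} \<and> X \<subseteq> V \<and> connected_in E X"
    and "sorted_wrt (\<lambda>X Y. X \<inter> Y = {} \<and> (\<exists>u\<in>X. \<exists>v\<in>Y. {u, v} \<in> E)) Bs"
  shows "has_K5_minor V E"
  unfolding has_K5_minor_def
proof (intro exI[of _ "\<lambda>i. Bs ! i"] conjI allI impI)
  fix i :: nat assume "i < 5"
  then show "Bs ! i \<noteq> {}" "Bs ! i \<subseteq> V" "connected_in E (Bs ! i)"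
    using assms(1,2) by (metis nth_mem)+
next
  have lt: "Bs ! i \<inter> Bs ! j = {} \<and> (\<exists>u\<in>Bs ! i. \<exists>v\<in>Bs ! j. {u, v} \<in> E)"
    if "i < j" "j < 5" for i j
    using assms(1,3) that by (simp add: sorted_wrt_iff_nth_less)
  fix i j :: nat assume ij: "i < 5" "j < 5" "i \<noteq> j"
  then consider "i < j" | "j < i" by linarith
  then have "Bs ! i \<inter> Bs ! j = {} \<and> (\<exists>u\<in>Bs ! i. \<exists>v\<in>Bs ! j. {u, v} \<in> E)"
  proof cases
    case 1
    then show ?thesis using lt ij by blast
  next
    case 2
    then show ?thesis using lt[of j i] ij by (metis Int_commute insert_commute)
  qed
  then show "Bs ! i \<inter> Bs ! j = {}" "\<exists>u\<in>Bs ! i. \<exists>v\<in>Bs ! j. {u, v} \<in> E" by blast+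
qed

text \<open>The vertex v is merged into u.\<close>

definition contract :: "'a set set \<Rightarrow> 'a \<Rightarrow> 'a \<Rightarrow> 'a set set" where
  "contract E u v = {e \<in> E. v \<notin> e} \<union> (\<lambda>w. {u, w}) ` (nbhd E v - {u})"

lemma contract_simple_graph:
  assumes "simple_graph V E" "{u, v} \<in> E"
  shows "simple_graph (V - {v}) (contract E u v)"
  unfolding simple_graph_def
proof (intro conjI ballI)
  show "finite (V - {v})" using assms(1) by (simp add: simple_graph_def)
  note uv = simple_graph_edge[OF assms]
  fix e assume "e \<in> contract E u v"
  then consider "e \<in> E" "v \<notin> e" | w where "w \<in> nbhd E v" "w \<noteq> u" "e = {u, w}"
    by (auto simp: contract_def)
  then show "\<exists>x y. e = {x, y} \<and> x \<noteq> y \<and> x \<in> V - {v} \<and> y \<in> V - {v}"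
  proof cases
    case 1
    from assms(1) 1(1) obtain x y where "e = {x, y}" "x \<noteq> y" "x \<in> V" "y \<in> V"
      by (rule simple_graph_edgeE)
    with 1 show ?thesis by auto
  next
    case 2
    then show ?thesis using nbhd_subset[OF assms(1), of v] uv by (intro exI[of _ u] exI[of _ w]) auto
  qed
qed

text \<open>Contraction loses the edge \<open>{u, v}\<close> and merges two edges into one for each
  common neighbour of \<open>u\<close> and \<open>v\<close>.\<close>

lemma contract_card:
  assumes "simple_graph V E" "{u, v} \<in> E"
  shows "card E \<le> card (contract E u v) + 1 + card (nbhd E u \<inter> nbhd E v)"
proof -
  have fE: "finite E" using assms(1) by (rule simple_graph_finite_edges)
  have fN: "finite (nbhd E v)" using assms(1) by (rule nbhd_finite)
  have uN: "u \<in> nbhd E v" using assms(2) by (simp add: nbhd_def)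
  have "u \<notin> nbhd E u" using nbhd_subset[OF assms(1)] by blast
  \<comment> \<open>The neighbours of \<open>v\<close> that give edges not yet present at
    \<open>u\<close>.\<close>
  let ?X = "nbhd E v - {u} - nbhd E u"
  let ?old = "{e \<in> E. v \<notin> e}" and ?new = "(\<lambda>w. {u, w}) ` ?X"
  have "card E = card ?old + card {e \<in> E. v \<in> e}"
  proof -
    have "E = ?old \<union> {e \<in> E. v \<in> e}" by auto
    then show ?thesis using fE by (metis (no_types, lifting) card_Un_disjoint disjoint_iff finite_Un mem_Collect_eq)
  qed
  also have "\<dots> = card ?old + card (nbhd E v)" using card_incident_edges[OF assms(1)] by simp
  also have "card (nbhd E v) = card ?X + 1 + card (nbhd E u \<inter> nbhd E v)"
  proof -
    have "nbhd E v = insert u (?X \<union> (nbhd E u \<inter> nbhd E v))" using uN by auto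
    moreover have "card (insert u (?X \<union> (nbhd E u \<inter> nbhd E v))) = Suc (card (?X \<union> (nbhd E u \<inter> nbhd E v)))"
      using fN \<open>u \<notin> nbhd E u\<close> by (intro card_insert_disjoint) auto
    moreover have "card (?X \<union> (nbhd E u \<inter> nbhd E v)) = card ?X + card (nbhd E u \<inter> nbhd E v)"
      using fN by (intro card_Un_disjoint) auto
    ultimately show ?thesis by simp
  qed
  also have "card ?X = card ?new"
    by (rule card_image[symmetric]) (auto simp: inj_on_def doubleton_eq_iff)
  finally have "card E = card ?old + card ?new + 1 + card (nbhd E u \<inter> nbhd E v)" by simp
  moreover have "card ?old + card ?new = card (?old \<union> ?new)"
    using fE fN by (intro card_Un_disjoint[symmetric]) (auto simp: nbhd_def insert_commute)
  moreover have "card (?old \<union> ?new) \<le> card (contract E u v)"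
    using fE fN by (intro card_mono) (auto simp: contract_def)
  ultimately show ?thesis by simp
qed

text \<open>An edge created at \<open>u\<close> by the contraction is replaced by a detour through
  \<open>v\<close>.\<close>

lemma connected_in_contract:
  assumes "connected_in (contract E u v) S" "v \<notin> S" "{u, v} \<in> E"
  shows "connected_in E (if u \<in> S then insert v S else S)"
proof (cases "u \<in> S")
  case False
  have "{a, b} \<in> E" if "a \<in> S" "b \<in> S" "{a, b} \<in> contract E u v" for a b
    using that False by (auto simp: contract_def doubleton_eq_iff)
  then have "(\<lambda>a b. a \<in> S \<and> b \<in> S \<and> {a, b} \<in> contract E u v)\<^sup>*\<^sup>*
      \<le> (\<lambda>a b. a \<in> S \<and> b \<in> S \<and> {a, b} \<in> E)\<^sup>*\<^sup>*"
    by (intro rtranclp_mono) auto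
  then show ?thesis using assms(1) False by (auto simp: connected_in_def)
next
  case True
  let ?r = "\<lambda>a b. a \<in> insert v S \<and> b \<in> insert v S \<and> {a, b} \<in> E"
  let ?q = "\<lambda>a b. a \<in> S \<and> b \<in> S \<and> {a, b} \<in> contract E u v"
  have uv: "?r\<^sup>*\<^sup>* u v" "?r\<^sup>*\<^sup>* v u" using True assms(3) by (auto simp: insert_commute)
  have step: "?r\<^sup>*\<^sup>* a b" if "?q a b" for a b
  proof (cases "{a, b} \<in> E")
    case True
    then show ?thesis using that by blast
  next
    case False
    then have "{a, b} \<in> (\<lambda>w. {u, w}) ` (nbhd E v - {u})" using that by (simp add: contract_def)
    then obtain w where "{a, b} = {u, w}" "w \<in> nbhd E v - {u}" by (rule imageE)
    then have w: "{a, b} = {u, w}" "w \<in> nbhd E v" by simp_all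
    then have "w \<in> S" using that by auto
    then have "?r\<^sup>*\<^sup>* v w" "?r\<^sup>*\<^sup>* w v" using w(2) by (auto simp: nbhd_def insert_commute)
    then have "?r\<^sup>*\<^sup>* u w" "?r\<^sup>*\<^sup>* w u" using uv by (meson rtranclp_trans)+
    then show ?thesis using w(1) by (auto simp: doubleton_eq_iff)
  qed
  have walk: "?r\<^sup>*\<^sup>* a b" if "?q\<^sup>*\<^sup>* a b" for a b
    using that by induction (use step in \<open>auto intro: rtranclp_trans\<close>)
  have "?r\<^sup>*\<^sup>* x u \<and> ?r\<^sup>*\<^sup>* u x" if "x \<in> insert v S" for x
    using that uv walk assms(1) True by (auto simp: connected_in_def)
  then have "?r\<^sup>*\<^sup>* x y" if "x \<in> insert v S" "y \<in> insert v S" for x y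
    using that by (meson rtranclp_trans)
  then show ?thesis using True by (simp add: connected_in_def)
qed

lemma has_K5_minor_contract:
  fixes V :: "'a set"
  assumes "simple_graph V E" "{u, v} \<in> E" "has_K5_minor (V - {v}) (contract E u v)"
  shows "has_K5_minor V E"
proof -
  obtain B :: "nat \<Rightarrow> 'a set"
    where B: "\<forall>i<5. B i \<noteq> {} \<and> B i \<subseteq> V - {v} \<and> connected_in (contract E u v) (B i)"
    "\<forall>i<5. \<forall>j<5. i \<noteq> j \<longrightarrow> B i \<inter> B j = {} \<and> (\<exists>x\<in>B i. \<exists>y\<in>B j. {x, y} \<in> contract E u v)"
    using assms(3) unfolding has_K5_minor_def by blast
  let ?B = "\<lambda>i. if u \<in> B i then insert v (B i) else B i"
  have vV: "v \<in> V" using simple_graph_edge[OF assms(1,2)] by simp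
  have "?B i \<noteq> {} \<and> ?B i \<subseteq> V \<and> connected_in E (?B i)" if "i < 5" for i
  proof -
    have "v \<notin> B i" using B(1) that by blast
    then have "connected_in E (?B i)" using B(1) that assms(2) by (intro connected_in_contract) auto
    then show ?thesis using B(1) that vV by auto
  qed
  moreover have "?B i \<inter> ?B j = {} \<and> (\<exists>x\<in>?B i. \<exists>y\<in>?B j. {x, y} \<in> E)"
    if ij: "i < 5" "j < 5" "i \<noteq> j" for i j
  proof -
    have disj: "B i \<inter> B j = {}" "v \<notin> B i" "v \<notin> B j" using B ij by blast+
    obtain x y where xy: "x \<in> B i" "y \<in> B j" "{x, y} \<in> contract E u v" using B(2) ij by meson
    have "\<exists>x\<in>?B i. \<exists>y\<in>?B j. {x, y} \<in> E"
    proof (cases "{x, y} \<in> E")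
      case True
      then show ?thesis using xy by (intro bexI[of _ x] bexI[of _ y]) auto
    next
      case False
      then have "{x, y} \<in> (\<lambda>w. {u, w}) ` (nbhd E v - {u})" using xy by (simp add: contract_def)
      then obtain w where "{x, y} = {u, w}" "w \<in> nbhd E v - {u}" by (rule imageE)
      then have w: "{x, y} = {u, w}" "w \<in> nbhd E v" by simp_all
      then consider "x = u" "y = w" | "x = w" "y = u" by (auto simp: doubleton_eq_iff)
      then show ?thesis
      proof cases
        case 1
        then show ?thesis using xy w(2) by (intro bexI[of _ v] bexI[of _ w]) (auto simp: nbhd_def insert_commute)
      next
        case 2
        then show ?thesis using xy w(2) by (intro bexI[of _ w] bexI[of _ v]) (auto simp: nbhd_def)
      qed
    qed
    moreover have "?B i \<inter> ?B j = {}" using disj by auto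
    ultimately show ?thesis by blast
  qed
  ultimately show ?thesis unfolding has_K5_minor_def by (intro exI[of _ ?B]) blast
qed

section \<open>A form of Mader's bound\<close>

text \<open>If the neighbourhood is complete, \<open>v\<close> and four neighbours form a K5.
  Otherwise it has five vertices, and contracting one edge at a non-adjacent pair leaves a K4 beside
  \<open>v\<close>.\<close>

lemma K5_minor_of_dense_neighbourhood:
  assumes G: "simple_graph V E" and N: "nbhd E v \<noteq> {}" "card (nbhd E v) \<le> 5" "v \<in> V"
    and tri: "\<And>u. u \<in> nbhd E v \<Longrightarrow> 3 \<le> card (nbhd E u \<inter> nbhd E v)"
  shows "has_K5_minor V E"
proof -
  let ?N = "nbhd E v"
  have finN: "finite ?N" using G by (rule nbhd_finite)
  have NV: "?N \<subseteq> V" "v \<notin> ?N" using nbhd_subset[OF G] by blast+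
  have vN: "{v, x} \<in> E" if "x \<in> ?N" for x using that by (simp add: nbhd_def insert_commute)
  have adj: "{x, y} \<in> E \<longleftrightarrow> y \<in> nbhd E x" for x y by (simp add: nbhd_def insert_commute)
  have sub: "nbhd E u \<inter> ?N \<subseteq> ?N - {u}" for u using nbhd_subset[OF G] by blast
  have clique: ?thesis if K: "K \<subseteq> ?N" "card K = 4" "\<And>x y. x \<in> K \<Longrightarrow> y \<in> K \<Longrightarrow> x \<noteq> y \<Longrightarrow> {x, y} \<in> E" for K
  proof -
    obtain a b c d where K4: "K = {a, b, c, d}" "distinct [a, b, c, d]"
      using K(2) by (auto simp: card_Suc_eq numeral_eq_Suc)
    show ?thesis
    proof (rule has_K5_minorI[of "[{v}, {a}, {b}, {c}, {d}]"])
      show "X \<noteq> {} \<and> X \<subseteq> V \<and> connected_in E X" if "X \<in> set [{v}, {a}, {b}, {c}, {d}]" for X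
        using that K(1) K4 NV N(3) by (auto simp: connected_in_singleton)
      show "sorted_wrt (\<lambda>X Y. X \<inter> Y = {} \<and> (\<exists>x\<in>X. \<exists>y\<in>Y. {x, y} \<in> E)) [{v}, {a}, {b}, {c}, {d}]"
        using K K4 NV vN by auto
    qed simp
  qed
  show ?thesis
  proof (cases "\<exists>a\<in>?N. \<exists>b\<in>?N. a \<noteq> b \<and> {a, b} \<notin> E")
    case False
    obtain u where u: "u \<in> ?N" using N(1) by blast
    have "3 \<le> card (?N - {u})" using tri[OF u] card_mono[OF _ sub[of u]] finN by (meson finite_Diff order_trans)
    then have "4 \<le> card ?N" using u finN by simp
    then obtain K where "K \<subseteq> ?N" "card K = 4" by (meson obtain_subset_with_card_n)
    with False show ?thesis by (intro clique[of K]) blast+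
  next
    case True
    then obtain a b where ab: "a \<in> ?N" "b \<in> ?N" "a \<noteq> b" "{a, b} \<notin> E" by blast
    \<comment> \<open>A non-adjacent pair leaves at most three candidates for the three required
      neighbours, so all of them are adjacent to both.\<close>
    have full: "nbhd E x \<inter> ?N = ?N - {x, y}" and five: "card ?N = 5"
      if "x \<in> ?N" "y \<in> ?N" "x \<noteq> y" "{x, y} \<notin> E" for x y
    proof -
      have s: "nbhd E x \<inter> ?N \<subseteq> ?N - {x, y}" using sub[of x] that adj by blast
      have c: "card (?N - {x, y}) = card ?N - 2" using that finN by (simp add: card_Diff_subset)
      have "3 \<le> card (?N - {x, y})" using tri[OF that(1)] card_mono[OF _ s] finN by (meson finite_Diff order_trans)
      then show "card ?N = 5" using c N(2) by linarith
      then have "card (?N - {x, y}) \<le> card (nbhd E x \<inter> ?N)" using tri[OF that(1)] c by simp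
      then show "nbhd E x \<inter> ?N = ?N - {x, y}" using s finN by (intro card_seteq) auto
    qed
    have a: "nbhd E a \<inter> ?N = ?N - {a, b}" and b: "nbhd E b \<inter> ?N = ?N - {b, a}"
      using full[of a b] full[of b a] ab by (auto simp: insert_commute)
    have c5: "card ?N = 5" using five ab by blast
    have "card (?N - {a, b}) = 3" using ab c5 finN by (simp add: card_Diff_subset)
    then have "?N - {a, b} \<noteq> {}" by (metis card.empty zero_neq_numeral)
    then obtain d where d: "d \<in> ?N" "d \<noteq> a" "d \<noteq> b" by blast
    have "\<not> nbhd E d \<inter> ?N \<subseteq> {a, b}"
    proof
      assume "nbhd E d \<inter> ?N \<subseteq> {a, b}"
      then have "card (nbhd E d \<inter> ?N) \<le> card {a, b}" by (intro card_mono) auto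
      then show False using tri[OF d(1)] ab(3) by simp
    qed
    then obtain e where e: "e \<in> nbhd E d" "e \<in> ?N" "e \<noteq> a" "e \<noteq> b" by blast
    have "d \<noteq> e" using e(1) nbhd_subset[OF G] by blast
    have "card (?N - {a, b, d, e}) = 1"
      using ab d e \<open>d \<noteq> e\<close> c5 finN by (simp add: card_Diff_subset)
    then obtain c where c: "c \<in> ?N" "c \<notin> {a, b, d, e}" by (metis DiffE card_1_singletonE insertI1)
    have E: "{a, c} \<in> E" "{a, d} \<in> E" "{a, e} \<in> E" "{b, c} \<in> E" "{b, d} \<in> E" "{b, e} \<in> E" "{d, e} \<in> E"
    proof -
      have "{c, d, e} \<subseteq> nbhd E a" "{c, d, e} \<subseteq> nbhd E b" using a b c d e by blast+
      then show "{a, c} \<in> E" "{a, d} \<in> E" "{a, e} \<in> E" "{b, c} \<in> E" "{b, d} \<in> E" "{b, e} \<in> E" "{d, e} \<in> E"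
        using e(1) by (simp_all add: adj)
    qed
    show ?thesis
    \<comment> \<open>Merging \<open>c\<close> into \<open>a\<close> supplies the missing adjacency
      to \<open>b\<close>, while \<open>a\<close> itself reaches \<open>d\<close> and
      \<open>e\<close>.\<close>
    proof (rule has_K5_minorI[of "[{v}, {a, c}, {b}, {d}, {e}]"])
      show "X \<noteq> {} \<and> X \<subseteq> V \<and> connected_in E X" if "X \<in> set [{v}, {a, c}, {b}, {d}, {e}]" for X
        using that ab c d e NV N(3) connected_in_edge[OF E(1)] by (auto simp: connected_in_singleton)
      show "sorted_wrt (\<lambda>X Y. X \<inter> Y = {} \<and> (\<exists>x\<in>X. \<exists>y\<in>Y. {x, y} \<in> E)) [{v}, {a, c}, {b}, {d}, {e}]"
        using E ab c d e NV vN \<open>d \<noteq> e\<close> by (auto simp: insert_commute)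
    qed simp
  qed
qed

text \<open>Contracting an edge in at most two triangles loses one vertex and at most three edges,
  so the bound is inherited. If no such edge exists, a vertex of degree at most 5 has a dense
  neighbourhood or is isolated and can be deleted.\<close>

theorem K5_minor_of_many_edges:
  assumes "simple_graph V E" "V \<noteq> {}" "3 * card V \<le> card E + 1"
  shows "has_K5_minor V E"
  using assms
proof (induction "card V" arbitrary: V E rule: less_induct)
  case less
  have finV: "finite V" using less.prems(1) by (simp add: simple_graph_def)
  have finE: "finite E" using less.prems(1) by (rule simple_graph_finite_edges)
  have pos: "1 \<le> card V" using finV less.prems(2) by (simp add: Suc_le_eq card_gt_0_iff)
  \<comment> \<open>Trimming to exactly \<open>3 * card V - 1\<close> edges keeps the degree sum
    below \<open>6 * card V\<close>, which provides a vertex of degree at most 5.\<close>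
  have "3 * card V - 1 \<le> card E" using less.prems(3) by simp
  then obtain F where F: "F \<subseteq> E" "card F = 3 * card V - 1" by (meson obtain_subset_with_card_n)
  have G: "simple_graph V F" using less.prems(1) F(1) by (auto simp: simple_graph_def)
  have "has_K5_minor V F"
  proof (cases "\<exists>u v. {u, v} \<in> F \<and> card (nbhd F u \<inter> nbhd F v) \<le> 2")
    case True
    then obtain u v where uv: "{u, v} \<in> F" "card (nbhd F u \<inter> nbhd F v) \<le> 2" by blast
    note uvV = simple_graph_edge[OF G uv(1)]
    have "card (V - {v}) < card V" using uvV finV by (intro card_Diff1_less) auto
    moreover have "3 * card (V - {v}) \<le> card (contract F u v) + 1"
      using contract_card[OF G uv(1)] uv(2) F(2) uvV finV pos by simp
    moreover have "V - {v} \<noteq> {}" using uvV by blast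
    ultimately have "has_K5_minor (V - {v}) (contract F u v)"
      using less.hyps contract_simple_graph[OF G uv(1)] by blast
    then show ?thesis using has_K5_minor_contract[OF G uv(1)] by blast
  next
    case False
    have "(\<Sum>v\<in>V. card (nbhd F v)) < 6 * card V" using handshake[OF G] F(2) pos by simp
    have "\<exists>v\<in>V. card (nbhd F v) \<le> 5"
    proof (rule ccontr)
      assume "\<not> ?thesis"
      then have "(\<Sum>v\<in>V. 6) \<le> (\<Sum>v\<in>V. card (nbhd F v))" by (intro sum_mono) force
      then show False using \<open>_ < 6 * card V\<close> by simp
    qed
    then obtain v where v: "v \<in> V" "card (nbhd F v) \<le> 5" by blast
    show ?thesis
    proof (cases "nbhd F v = {}")
      case False
      have "3 \<le> card (nbhd F u \<inter> nbhd F v)" if "u \<in> nbhd F v" for u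
        using \<open>\<not> (\<exists>u v. _ u v)\<close> that unfolding nbhd_def by fastforce
      then show ?thesis using K5_minor_of_dense_neighbourhood[OF G False v(2,1)] by blast
    next
      case True
      have sub: "e \<subseteq> V - {v}" if eF: "e \<in> F" for e
      proof -
        obtain x y where "e = {x, y}" "x \<in> V" "y \<in> V" using simple_graph_edgeE[OF G eF] by blast
        then show ?thesis using True eF by (auto simp: nbhd_def insert_commute)
      qed
      have "card F \<noteq> 0" using F(2) pos by simp
      then obtain e where "e \<in> F" by fastforce
      then have "V - {v} \<noteq> {}" using sub[of e] G by (auto simp: simple_graph_def)
      moreover have "simple_graph (V - {v}) F"
      proof -
        have "edges_in F (V - {v}) = F" using sub by (auto simp: edges_in_def)
        then show ?thesis using simple_graph_edges_in[OF G, of "V - {v}"] by simp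
      qed
      moreover have "card (V - {v}) < card V" using v finV by (intro card_Diff1_less) auto
      moreover have "3 * card (V - {v}) \<le> card F + 1" using F(2) v finV by simp
      ultimately have "has_K5_minor (V - {v}) F" using less.hyps by blast
      then show ?thesis by (rule has_K5_minor_mono) auto
    qed
  qed
  then show ?case using F(1) by (rule has_K5_minor_mono[OF _ order_refl])
qed

section \<open>Correspondence covers\<close>

text \<open>Numbering the lists turns the cover into a conflict system; index \<open>i\<close> of
  the resulting permutations reads off the \<open>i\<close>-th transversal. Handshaking translates
  the edge bound into the degree bound.\<close>

lemma cover_has_packing:
  fixes V :: "'a set"
  assumes G: "simple_graph V E" and cover: "k_fold_cover 8 V E L HE"
    and sparse: "\<And>W. W \<subseteq> V \<Longrightarrow> W \<noteq> {} \<Longrightarrow> card (edges_in E W) < 3 * card W"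
  shows "has_packing 8 V L HE"
proof -
  have finL: "finite (L v)" "card (L v) = 8" if "v \<in> V" for v
    using cover that by (auto simp: k_fold_cover_def)
  have "corr_cover V E L HE" using cover by (simp add: k_fold_cover_def)
  note C = this[unfolded corr_cover_def]
  note H = C[THEN conjunct1]
  note disj = C[THEN conjunct2, THEN conjunct1, rule_format]
  note nonadj = C[THEN conjunct2, THEN conjunct2, THEN conjunct2, THEN conjunct1, rule_format]
  note matching = C[THEN conjunct2, THEN conjunct2, THEN conjunct2, THEN conjunct2, rule_format]
  have "\<exists>b. bij_betw b {..<8::nat} (L v)" if "v \<in> V" for v
    using ex_bij_betw_nat_finite[OF finL(1)[OF that]] finL(2)[OF that] by (simp add: atLeast0LessThan)
  then obtain b where b: "\<And>v. v \<in> V \<Longrightarrow> bij_betw (b v) {..<8::nat} (L v)" by metis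
  have bL: "b v i \<in> L v" if "v \<in> V" "i < 8" for v i using b[OF that(1)] that(2) by (auto simp: bij_betw_def)
  have b_inj: "i = j" if "b v i = b v j" "v \<in> V" "i < 8" "j < 8" for v i j
    using b[OF that(2)] that by (auto simp: bij_betw_def dest: inj_onD)
  define R where "R u v = {(x, y). x < 8 \<and> y < 8 \<and> {u, v} \<in> E \<and> {b u x, b v y} \<in> HE}" for u v
  have sv: "single_valued (R u v)" for u v
  proof (rule single_valuedI)
    fix x y z assume yz: "(x, y) \<in> R u v" "(x, z) \<in> R u v"
    then have uv: "u \<in> V" "v \<in> V" using simple_graph_edge[OF G, of u v] by (auto simp: R_def)
    then have "b v y = b v z"
      using matching[of u v "b u x" "b v y" "b v z"] bL yz by (auto simp: R_def)
    then show "y = z" using b_inj uv yz by (auto simp: R_def)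
  qed
  have conv: "R v u = (R u v)\<inverse>" for u v by (auto simp: R_def insert_commute)
  interpret conflict_system "nbhd E" R
  proof
    show "R u v \<subseteq> {..<8} \<times> {..<8}" for u v by (auto simp: R_def)
    show "partial_matching (R u v)" for u v using sv conv[of v u] sv[of v u] by (simp add: partial_matching_def)
    show "R v u = (R u v)\<inverse>" for u v by (rule conv)
    show "R u v = {}" if "u \<notin> nbhd E v" for u v using that by (auto simp: R_def nbhd_def)
    show "v \<in> nbhd E u" if "u \<in> nbhd E v" for u v using that nbhd_sym by fast
    show "v \<notin> nbhd E v" for v using nbhd_subset[OF G, of v] by blast
  qed
  have "\<exists>f. packs V f"
  proof (rule sparse_packs)
    show "finite V" using G by (simp add: simple_graph_def)
    fix W assume W: "W \<subseteq> V" "W \<noteq> {}"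
    have "nbhd (edges_in E W) v = nbhd E v \<inter> W" if "v \<in> W" for v
      using that by (auto simp: nbhd_def edges_in_def)
    then have "(\<Sum>v\<in>W. card (nbhd E v \<inter> W)) = (\<Sum>v\<in>W. card (nbhd (edges_in E W) v))" by simp
    also have "\<dots> = 2 * card (edges_in E W)" using simple_graph_edges_in[OF G W(1)] by (rule handshake)
    finally show "(\<Sum>v\<in>W. card (nbhd E v \<inter> W)) < 6 * card W" using sparse[OF W] by simp
  qed
  then obtain f where f: "packs V f" by blast
  have f8: "f v i < 8" if "v \<in> V" "i < 8" for v i using f that by (auto simp: packs_def bij_betw_def)
  define T where "T i = (\<lambda>v. b v (f v i)) ` V" for i
  \<comment> \<open>The lists are disjoint, so no other vertex contributes an element of
    \<open>L v\<close>.\<close>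
  have T_L: "T i \<inter> L v = {b v (f v i)}" if "v \<in> V" "i < 8" for v i
    using that bL f8 disj unfolding T_def by blast
  have "indep_transversal V L HE (T i)" if i: "i < 8" for i
    unfolding indep_transversal_def
  proof (intro conjI ballI)
    show "T i \<subseteq> \<Union>(L ` V)" using bL f8 i by (auto simp: T_def)
    show "card (T i \<inter> L v) = 1" if "v \<in> V" for v using T_L[OF that i] by simp
    fix x y assume "x \<in> T i" "y \<in> T i"
    then obtain u v where uv: "u \<in> V" "v \<in> V" "x = b u (f u i)" "y = b v (f v i)" by (auto simp: T_def)
    show "{x, y} \<notin> HE"
    proof (cases "u = v")
      case True
      then show ?thesis using uv simple_graph_edge(3)[OF H, of x y] by auto
    next
      case False
      show ?thesis
      proof
        assume xy: "{x, y} \<in> HE"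
        then have "{u, v} \<in> E" using nonadj[of u v x y] False uv bL f8 i by auto
        then have "(f u i, f v i) \<in> R u v" using xy uv f8 i by (auto simp: R_def)
        then show False using f uv i by (auto simp: packs_def)
      qed
    qed
  qed
  moreover have "T i \<inter> T j = {}" if ij: "i < 8" "j < 8" "i \<noteq> j" for i j
  proof (rule ccontr)
    assume "T i \<inter> T j \<noteq> {}"
    then obtain u v where uv: "u \<in> V" "v \<in> V" "b u (f u i) = b v (f v j)" unfolding T_def by blast
    have "b u (f u i) \<in> L u \<inter> L v" using bL[OF uv(1) f8[OF uv(1) ij(1)]] bL[OF uv(2) f8[OF uv(2) ij(2)]] uv(3) by simp
    then have "u = v" using disj[OF uv(1,2)] by blast
    then have "f u i = f u j" using b_inj[of u "f u i" "f u j"] uv f8 ij by auto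
    moreover have "inj_on (f u) {..<8}" using f uv(1) by (simp add: packs_def bij_betw_def)
    ultimately show False using ij by (auto dest: inj_onD)
  qed
  ultimately show ?thesis unfolding has_packing_def by blast
qed

lemma sparse_chi_c_star:
  assumes "simple_graph V E" "\<And>W. W \<subseteq> V \<Longrightarrow> W \<noteq> {} \<Longrightarrow> card (edges_in E W) < 3 * card W"
  shows "chi_c_star V E \<le> 8"
  unfolding chi_c_star_def using cover_has_packing[OF assms(1) _ assms(2)] by (intro Least_le) auto

text \<open>\<open>Max\<close> bounds the elements of a finite set only; finiteness holds as there
  are finitely many subgraphs.\<close>

lemma mad_edges_in:
  assumes G: "simple_graph V E" and W: "W \<subseteq> V" "W \<noteq> {}"
  shows "2 * real (card (edges_in E W)) / real (card W) \<le> mad V E"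
proof -
  let ?S = "{2 * real (card E') / real (card V') | V' E'.
                   V' \<subseteq> V \<and> V' \<noteq> {} \<and> E' \<subseteq> E \<and> (\<forall>e\<in>E'. e \<subseteq> V')}"
  have "?S \<subseteq> (\<lambda>(V', E'). 2 * real (card E') / real (card V')) ` (Pow V \<times> Pow E)" by auto
  moreover have "finite (Pow V \<times> Pow E)"
    using G simple_graph_finite_edges[OF G] by (simp add: simple_graph_def)
  ultimately have "finite ?S" by (meson finite_imageI finite_subset)
  moreover have "2 * real (card (edges_in E W)) / real (card W) \<in> ?S"
    using W by (intro CollectI exI[of _ W] exI[of _ "edges_in E W"]) (auto simp: edges_in_def)
  ultimately show ?thesis unfolding mad_def by (rule Max_ge)
qed

text \<open>Both conjuncts rest on the same bound of fewer than \<open>3 * card W\<close> edges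
  inside every non-empty \<open>W\<close>. Planar graphs have no K5 minor and fall under the second
  one.\<close>

theorem mainTheorem4:
  fixes V :: "'a set" and E :: "'a set set"
  assumes "simple_graph V E"
  shows "(mad V E < 6 \<longrightarrow> chi_c_star V E \<le> 8) \<and>
         (\<not> has_K5_minor V E \<longrightarrow> chi_c_star V E \<le> 8)"
proof (intro conjI impI)
  have finV: "finite V" using assms by (simp add: simple_graph_def)
  assume mad: "mad V E < 6"
  show "chi_c_star V E \<le> 8"
  proof (rule sparse_chi_c_star[OF assms])
    fix W assume W: "W \<subseteq> V" "W \<noteq> {}"
    have "card W > 0" using W finV by (simp add: card_gt_0_iff finite_subset)
    moreover have "2 * real (card (edges_in E W)) / real (card W) < 6"
      using mad_edges_in[OF assms W] mad by linarith
    ultimately have "2 * real (card (edges_in E W)) < 6 * real (card W)" by (simp add: field_simps)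
    then show "card (edges_in E W) < 3 * card W" by linarith
  qed
next
  assume minor: "\<not> has_K5_minor V E"
  show "chi_c_star V E \<le> 8"
  proof (rule sparse_chi_c_star[OF assms], rule ccontr)
    fix W assume W: "W \<subseteq> V" "W \<noteq> {}" "\<not> card (edges_in E W) < 3 * card W"
    then have "has_K5_minor W (edges_in E W)"
      by (intro K5_minor_of_many_edges simple_graph_edges_in[OF assms]) auto
    then have "has_K5_minor V E" using W(1) by (rule has_K5_minor_mono) (auto simp: edges_in_def)
    with minor show False ..
  qed
qed

end
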